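(* Let $a_1,\dots,a_6$ be non-negative integers, not all zero, such that $a_1+a_6\ge\max\{a_2+a_5,\ a_3+a_4\}$. Let $$\mathcal A=\max\{a_2+a_5,\ a_3+a_4,\ a_2+a_4-a_6+1,\ a_3+a_5-a_6+1,\ a_2+a_3-a_1+1,\ a_4+a_5-a_1+1\}.$$ Then the tetrahedral curve $C=C(a_1,\dots,a_6)$ is arithmetically Buchsbaum if and only if one of the following conditions is satisfied: (i) $a_1=0$ or $a_6=0$; (ii) $a_1+a_6-2\le\mathcal A$.
   Context: $K$ is a field, $R=K[x_1,x_2,x_3,x_4]$, $\mathfrak m=(x_1,x_2,x_3,x_4)$. For non-negative integers $a_1,\dots,a_6$, not all zero, the tetrahedral curve $C(a_1,\dots,a_6)$ is the curve in $\mathbb P^3$ defined by the ideal $$I=(x_1,x_2)^{a_1}\cap(x_1,x_3)^{a_2}\cap(x_1,x_4)^{a_3}\cap(x_2,x_3)^{a_4}\cap(x_2,x_4)^{a_5}\cap(x_3,x_4)^{a_6}$$ of $R$, where $\mathfrak p^0=R$. $C$ is arithmetically Buchsbaum if and only if $k(R/I)\le1$, where $k(R/I)$ is the smallest non-negative integer $k$ with $\mathfrak m^kH^1_{\mathfrak m}(R/I)=0$; that is, if and only if $\mathfrak m H^1_{\mathfrak m}(R/I)=0$ (arithmetically Cohen-Macaulay curves, for which $H^1_{\mathfrak m}(R/I)=0$, are included). *)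

theory Defs
  imports
    "HOL-Algebra.Algebraic_Closure_Type"
    "HOL-Algebra.Ideal_Product"
    "HOL-Library.Poly_Mapping"
    "HOL-Library.Numeral_Type"
    "HOL-Library.Extended_Nat"
begin

section \<open>Quotients and localizations of modules\<close>

definition ring_as_module :: "('a, 'm) ring_scheme \<Rightarrow> ('a, 'a) module" where
  "ring_as_module R =
     \<lparr>carrier = carrier R, monoid.mult = monoid.mult R, one = monoid.one R, zero = ring.zero R, add = ring.add R,
      module.smult = monoid.mult R\<rparr>"

text \<open>
  The \<open>module\<close> record extends the ring record; the fields \<open>mult\<close> and \<open>one\<close> play no role for
  modules and are left unspecified below.
\<close>

definition quotient_module :: "('a, 'b, 'm) module_scheme \<Rightarrow> 'b set \<Rightarrow> ('a, 'b set) module" where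
  "quotient_module M N =
     \<lparr>carrier = a_rcosets\<^bsub>M\<^esub> N, monoid.mult = undefined, one = undefined, zero = N, add = set_add M,
      module.smult = (\<lambda>r A. \<Union>m\<in>A. N +>\<^bsub>M\<^esub> (r \<odot>\<^bsub>M\<^esub> m))\<rparr>"

text \<open>
  The localization \<open>M\<^sub>s\<close> at the powers of \<open>s\<close>: the pair \<open>(m, i)\<close> stands for the fraction
  \<open>m / s^i\<close>, and elements of \<open>M\<^sub>s\<close> are the equivalence classes of such pairs. Each union below
  runs over all representatives; by compatibility with the equivalence all its members coincide.
\<close>

definition fraction_rel ::
  "('a, 'n) ring_scheme \<Rightarrow> ('a, 'b, 'm) module_scheme \<Rightarrow> 'a \<Rightarrow> (('b \<times> nat) \<times> ('b \<times> nat)) set" where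
  "fraction_rel R M s =
     {((m, i), (n, j)) | m i n j. m \<in> carrier M \<and> n \<in> carrier M \<and>
        (\<exists>k. (s [^]\<^bsub>R\<^esub> (k + j)) \<odot>\<^bsub>M\<^esub> m = (s [^]\<^bsub>R\<^esub> (k + i)) \<odot>\<^bsub>M\<^esub> n)}"

definition fraction ::
  "('a, 'n) ring_scheme \<Rightarrow> ('a, 'b, 'm) module_scheme \<Rightarrow> 'a \<Rightarrow> 'b \<Rightarrow> nat \<Rightarrow> ('b \<times> nat) set" where
  "fraction R M s m i = fraction_rel R M s `` {(m, i)}"

definition localization ::
  "('a, 'n) ring_scheme \<Rightarrow> ('a, 'b, 'm) module_scheme \<Rightarrow> 'a \<Rightarrow> ('a, ('b \<times> nat) set) module" where
  "localization R M s =
     \<lparr>carrier = {fraction R M s m i | m i. m \<in> carrier M},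
      monoid.mult = undefined, one = undefined,
      zero = fraction R M s \<zero>\<^bsub>M\<^esub> 0,
      add = (\<lambda>A B. \<Union>(m, i)\<in>A. \<Union>(n, j)\<in>B.
               fraction R M s ((s [^]\<^bsub>R\<^esub> j) \<odot>\<^bsub>M\<^esub> m \<oplus>\<^bsub>M\<^esub> (s [^]\<^bsub>R\<^esub> i) \<odot>\<^bsub>M\<^esub> n) (i + j)),
      module.smult = (\<lambda>r A. \<Union>(m, i)\<in>A. fraction R M s (r \<odot>\<^bsub>M\<^esub> m) i)\<rparr>"

text \<open>The canonical map from \<open>M\<^sub>s\<close> to \<open>M\<^sub>s\<^sub>y\<close>, sending \<open>m / s^i\<close> to \<open>(y^i m) / (s y)^i\<close>.\<close>

definition localization_map ::
  "('a, 'n) ring_scheme \<Rightarrow> ('a, 'b, 'm) module_scheme \<Rightarrow> 'a \<Rightarrow> 'a \<Rightarrow>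
     ('b \<times> nat) set \<Rightarrow> ('b \<times> nat) set" where
  "localization_map R M s y A =
     (\<Union>(m, i)\<in>A. fraction R M (s \<otimes>\<^bsub>R\<^esub> y) ((y [^]\<^bsub>R\<^esub> i) \<odot>\<^bsub>M\<^esub> m) i)"


section \<open>Local cohomology\<close>

text \<open>
  \<open>H\<^sup>p\<close> of \<open>M\<close> with support in the ideal generated by a finite family \<open>x\<close> (indexed by \<open>J\<close>) is the
  cohomology of the Cech complex, whose term in degree \<open>p\<close> is the direct sum of the modules
  \<open>M\<^sub>x\<^sub>S\<close> over the \<open>p\<close>-element subsets \<open>S\<close> of \<open>J\<close>, where \<open>x\<^sub>S\<close> is the product of the \<open>x\<^sub>i\<close>
  with \<open>i \<in> S\<close>. The order of the index type enters only through the usual signs.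
\<close>

definition index_product :: "('a, 'n) ring_scheme \<Rightarrow> ('i \<Rightarrow> 'a) \<Rightarrow> 'i set \<Rightarrow> 'a" where
  "index_product R x S = (\<Otimes>\<^bsub>R\<^esub>i\<in>S. x i)"

definition cech_term ::
  "('a, 'n) ring_scheme \<Rightarrow> ('i \<Rightarrow> 'a) \<Rightarrow> ('a, 'b, 'm) module_scheme \<Rightarrow> 'i set \<Rightarrow>
     ('a, ('b \<times> nat) set) module" where
  "cech_term R x M S = localization R M (index_product R x S)"

definition cech_module ::
  "('a, 'n) ring_scheme \<Rightarrow> 'i set \<Rightarrow> ('i \<Rightarrow> 'a) \<Rightarrow> ('a, 'b, 'm) module_scheme \<Rightarrow> nat \<Rightarrow>
     ('a, 'i set \<Rightarrow> ('b \<times> nat) set) module" where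
  "cech_module R J x M p = (let F = {S. S \<subseteq> J \<and> card S = p} in
     \<lparr>carrier = (\<Pi>\<^sub>E S\<in>F. carrier (cech_term R x M S)),
      monoid.mult = undefined, one = undefined,
      zero = (\<lambda>S\<in>F. \<zero>\<^bsub>cech_term R x M S\<^esub>),
      add = (\<lambda>c d. \<lambda>S\<in>F. c S \<oplus>\<^bsub>cech_term R x M S\<^esub> d S),
      module.smult = (\<lambda>r c. \<lambda>S\<in>F. r \<odot>\<^bsub>cech_term R x M S\<^esub> c S)\<rparr>)"

definition cech_differential ::
  "('a, 'n) ring_scheme \<Rightarrow> 'i::linorder set \<Rightarrow> ('i \<Rightarrow> 'a) \<Rightarrow> ('a, 'b, 'm) module_scheme \<Rightarrow> nat \<Rightarrow>
     ('i set \<Rightarrow> ('b \<times> nat) set) \<Rightarrow> 'i set \<Rightarrow> ('b \<times> nat) set" where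
  "cech_differential R J x M p c =
     (\<lambda>T\<in>{T. T \<subseteq> J \<and> card T = p + 1}.
        \<Oplus>\<^bsub>cech_term R x M T\<^esub>k\<in>T.
          ((\<ominus>\<^bsub>R\<^esub> \<one>\<^bsub>R\<^esub>) [^]\<^bsub>R\<^esub> card {j \<in> T. j < k}) \<odot>\<^bsub>cech_term R x M T\<^esub>
            localization_map R M (index_product R x (T - {k})) (x k) (c (T - {k})))"

definition cech_cocycles ::
  "('a, 'n) ring_scheme \<Rightarrow> 'i::linorder set \<Rightarrow> ('i \<Rightarrow> 'a) \<Rightarrow> ('a, 'b, 'm) module_scheme \<Rightarrow> nat \<Rightarrow>
     ('i set \<Rightarrow> ('b \<times> nat) set) set" where
  "cech_cocycles R J x M p =
     {c \<in> carrier (cech_module R J x M p).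
        cech_differential R J x M p c = \<zero>\<^bsub>cech_module R J x M (p + 1)\<^esub>}"

definition cech_coboundaries ::
  "('a, 'n) ring_scheme \<Rightarrow> 'i::linorder set \<Rightarrow> ('i \<Rightarrow> 'a) \<Rightarrow> ('a, 'b, 'm) module_scheme \<Rightarrow> nat \<Rightarrow>
     ('i set \<Rightarrow> ('b \<times> nat) set) set" where
  "cech_coboundaries R J x M p =
     (case p of
        0 \<Rightarrow> {\<zero>\<^bsub>cech_module R J x M 0\<^esub>}
      | Suc q \<Rightarrow> cech_differential R J x M q ` carrier (cech_module R J x M q))"

definition local_cohomology ::
  "('a, 'n) ring_scheme \<Rightarrow> 'i::linorder set \<Rightarrow> ('i \<Rightarrow> 'a) \<Rightarrow> nat \<Rightarrow> ('a, 'b, 'm) module_scheme \<Rightarrow>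
     ('a, ('i set \<Rightarrow> ('b \<times> nat) set) set) module" where
  "local_cohomology R J x p M =
     quotient_module ((cech_module R J x M p)\<lparr>carrier := cech_cocycles R J x M p\<rparr>)
       (cech_coboundaries R J x M p)"

definition annihilates :: "'a set \<Rightarrow> ('a, 'b, 'm) module_scheme \<Rightarrow> bool" where
  "annihilates \<aa> M \<longleftrightarrow> (\<forall>r\<in>\<aa>. \<forall>h\<in>carrier M. r \<odot>\<^bsub>M\<^esub> h = \<zero>\<^bsub>M\<^esub>)"


section \<open>The polynomial ring in four variables\<close>

text \<open>
  The four-element type \<open>4\<close> of residues modulo 4 indexes the variables: a monomial is an exponent
  function on it. The numerals \<open>1, 2, 3, 4\<close> are its four distinct elements, with \<open>4 = 0\<close>.
\<close>

type_synonym 'k poly4 = "(4 \<Rightarrow>\<^sub>0 nat) \<Rightarrow>\<^sub>0 'k"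

abbreviation poly4_ring :: "'k::field poly4 ring" where
  "poly4_ring \<equiv> ring_of_type_algebra"

definition xvar :: "4 \<Rightarrow> 'k::field poly4" where
  "xvar i = Poly_Mapping.single (Poly_Mapping.single i 1) 1"

definition max_ideal :: "'k::field poly4 set" where
  "max_ideal = Idl\<^bsub>poly4_ring\<^esub> {xvar 1, xvar 2, xvar 3, xvar 4}"

definition ideal_power :: "('a, 'n) ring_scheme \<Rightarrow> 'a set \<Rightarrow> nat \<Rightarrow> 'a set" where
  "ideal_power R I n = I [^]\<^bsub>ideals_set R\<^esub> n"

definition line_power :: "4 \<Rightarrow> 4 \<Rightarrow> nat \<Rightarrow> 'k::field poly4 set" where
  "line_power i j a = ideal_power poly4_ring (Idl\<^bsub>poly4_ring\<^esub> {xvar i, xvar j}) a"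

definition tetrahedral_ideal ::
  "nat \<Rightarrow> nat \<Rightarrow> nat \<Rightarrow> nat \<Rightarrow> nat \<Rightarrow> nat \<Rightarrow> 'k::field poly4 set" where
  "tetrahedral_ideal a1 a2 a3 a4 a5 a6 =
     line_power 1 2 a1 \<inter> line_power 1 3 a2 \<inter> line_power 1 4 a3 \<inter>
     line_power 2 3 a4 \<inter> line_power 2 4 a5 \<inter> line_power 3 4 a6"

definition H1_m :: "'k::field poly4 set \<Rightarrow>
    ('k poly4, (4 set \<Rightarrow> ('k poly4 set \<times> nat) set) set) module" where
  "H1_m I =
     local_cohomology poly4_ring UNIV xvar 1 (quotient_module (ring_as_module poly4_ring) I)"

text \<open>The infimum of the empty set is \<open>\<infinity>\<close>, the value when no power of \<open>max_ideal\<close> annihilates.\<close>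

definition k_invariant :: "'k::field poly4 set \<Rightarrow> enat" where
  "k_invariant I = Inf {enat k | k. annihilates (ideal_power poly4_ring max_ideal k) (H1_m I)}"

text \<open>The curve is represented by its defining ideal \<open>I\<close>.\<close>

definition arithmetically_Buchsbaum :: "'k::field poly4 set \<Rightarrow> bool" where
  "arithmetically_Buchsbaum I \<longleftrightarrow> k_invariant I \<le> 1"

end

theory Submission
  imports Defs
begin

text \<open>
  The ideal \<open>I\<close> of a tetrahedral curve is a monomial ideal: a polynomial belongs to it if and only if
  every exponent vector \<open>w\<close> in its support satisfies \<open>w i + w j \<ge> \<alpha> i j\<close> for each of the six pairs
  \<open>i, j\<close>, where \<open>\<alpha> i j\<close> is the multiplicity of the line with ideal \<open>(x\<^sub>i, x\<^sub>j)\<close>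
  (\<open>line_power_eq_order_ideal\<close>, \<open>tetrahedral_ideal_eq\<close>). Hence the first local cohomology of
  the residue class ring splits into multidegrees, and each piece can be read off from the graph \<open>G\<^sub>u\<close> on
  the four variables whose edges are the violated pairs, \<open>u i + u j < \<alpha> i j\<close>.

  A Cech 1-cochain is a family of fractions \<open>f\<^sub>k / x\<^sub>k\<^sup>n\<close>. Let \<open>c\<^sub>k(u)\<close> be the coefficient of \<open>f\<^sub>k\<close> at
  \<open>u + n e\<^sub>k\<close>, where \<open>e\<^sub>k\<close> is the \<open>k\<close>-th unit vector. The fraction \<open>f\<^sub>k / x\<^sub>k\<^sup>n\<close> sees degree \<open>u\<close> if and
  only if some edge of \<open>G\<^sub>u\<close> avoids \<open>k\<close>. The cocycle condition says that each edge of \<open>G\<^sub>u\<close> forces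
  \<open>c\<^sub>j(u) = c\<^sub>k(u)\<close> for the two remaining vertices \<open>j\<close> and \<open>k\<close>, together with the vanishing of the
  coefficients in degrees that are negative at \<open>k\<close>; the coboundary condition asks that the visible
  \<open>c\<^sub>k(u)\<close> are all equal, with common value the coefficient at \<open>u\<close> of one polynomial. Passing to
  complements of edges turns this into connectivity: the visible values can differ only if \<open>G\<^sub>u\<close> consists of
  exactly two disjoint edges (\<open>coeffs_equal_or_exact_matching\<close>). In that case the degree-\<open>u\<close> part
  of the cohomology is one-dimensional, in all other degrees it vanishes. Multiplication by \<open>x\<^sub>l\<close> goes from degree
  \<open>u\<close> to degree \<open>u + e\<^sub>l\<close>; it is zero unless both graphs are exact matchings, which are then the
  same matching, and in this case it is injective. So the maximal ideal annihilates the cohomology if and only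
  if no \<open>u\<close> and \<open>l\<close> have \<open>G\<^sub>u\<close> and \<open>G\<close> at \<open>u + e\<^sub>l\<close> equal to the same perfect matching
  (\<open>annihilates_max_ideal_iff\<close>).

  When \<open>a1 + a6\<close> is at least \<open>a2 + a5\<close> and \<open>a3 + a4\<close>, summing the inequalities leaves only the
  matching \<open>{12, 34}\<close>. The forbidden pair \<open>u\<close>, \<open>u + e\<^sub>l\<close> then amounts to a lattice point of a polytope with
  \<open>u 1 + u 2 = s < a1\<close> and \<open>u 3 + u 4 = t < a6\<close>, where one of these two inequalities has slack. Eliminating
  the variables gives the six linear inequalities of the criterion. A parity obstruction
  could arise from the factors 2 in the elimination; choosing suitably between \<open>(a1 - 2, a6 - 1)\<close> and
  \<open>(a1 - 1, a6 - 2)\<close> for \<open>(s, t)\<close> always avoids it (\<open>matching_slack_iff\<close>).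
\<close>

section \<open>A commutative ring type as a ring with carrier\<close>

abbreviation "R \<equiv> ring_of_type_algebra"

lemma ring_of_type_algebra_simps [simp]:
  fixes r s :: "'a::comm_ring_1"
  shows "carrier (R :: 'a ring) = UNIV" "r \<otimes>\<^bsub>R\<^esub> s = r * s" "r \<oplus>\<^bsub>R\<^esub> s = r + s"
    "\<one>\<^bsub>R\<^esub> = (1::'a)" "\<zero>\<^bsub>R\<^esub> = (0::'a)"
  by (simp_all add: ring_of_type_algebra_def)

lemma cring_R: "cring (R :: 'a::comm_ring_1 ring)"
  by (rule cring_from_type_algebra)

lemma pow_R [simp]: "(r::'a::comm_ring_1) [^]\<^bsub>R\<^esub> (n::nat) = r ^ n"
proof -
  interpret cring "R :: 'a ring" by (rule cring_R)
  show ?thesis by (induction n) (auto simp: mult.commute)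
qed

lemma a_inv_R [simp]: "\<ominus>\<^bsub>R\<^esub> (r::'a::comm_ring_1) = - r"
proof -
  interpret cring "R :: 'a ring" by (rule cring_R)
  show ?thesis by (rule minus_equality) auto
qed

lemma finprod_R [simp]: "finite S \<Longrightarrow> finprod R x S = (prod x S :: 'a::comm_ring_1)"
proof -
  interpret cring "R :: 'a ring" by (rule cring_R)
  show "finite S \<Longrightarrow> finprod R x S = prod x S"
    by (induction S rule: finite_induct) simp_all
qed

lemma ideal_R_I:
  fixes S :: "'a::comm_ring_1 set"
  assumes "0 \<in> S" "\<And>f g. f \<in> S \<Longrightarrow> g \<in> S \<Longrightarrow> f + g \<in> S" "\<And>r f. f \<in> S \<Longrightarrow> r * f \<in> S"
  shows "ideal S R"
proof -
  interpret cring "R :: 'a ring" by (rule cring_R)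
  show ?thesis
  proof (rule idealI[OF ring_axioms])
    show "subgroup S (add_monoid R)"
    proof (rule add.subgroupI)
      fix f assume "f \<in> S"
      then show "\<ominus>\<^bsub>R\<^esub> f \<in> S"
        using assms(3)[of f "-1"] by simp
    qed (use assms in auto)
  qed (use assms in \<open>auto simp: mult.commute\<close>)
qed

section \<open>The residue class module and its localizations\<close>

text \<open>
  The Cech complex is built from sets: cosets of \<open>I\<close>, and classes of fractions of such cosets. The lemmas
  of this locale translate every operation on these sets into ring arithmetic modulo \<open>I\<close>, with
  \<open>cl f\<close> for the residue class of \<open>f\<close> and \<open>lfrac s f i\<close> for the fraction with numerator \<open>cl f\<close>
  and denominator the \<open>i\<close>-th power of \<open>s\<close>.
\<close>

locale ring_mod_ideal =
  fixes I :: "'a::comm_ring_1 set"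
  assumes ideal: "ideal I R"
begin

lemma I_zero: "0 \<in> I" and I_add: "f \<in> I \<Longrightarrow> g \<in> I \<Longrightarrow> f + g \<in> I"
  and I_mult: "f \<in> I \<Longrightarrow> r * f \<in> I"
proof -
  interpret ideal I R by (rule ideal)
  show "0 \<in> I" using additive_subgroup.zero_closed[OF is_additive_subgroup] by simp
  show "f \<in> I \<Longrightarrow> g \<in> I \<Longrightarrow> f + g \<in> I" using additive_subgroup.a_closed[OF is_additive_subgroup, of f g] by simp
  show "f \<in> I \<Longrightarrow> r * f \<in> I" using I_l_closed[of f r] by simp
qed

lemma I_minus: "f \<in> I \<Longrightarrow> - f \<in> I" using I_mult[of f "-1"] by simp
lemma I_diff: "f \<in> I \<Longrightarrow> g \<in> I \<Longrightarrow> f - g \<in> I"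
  using I_add[of f "-g"] I_minus[of g] by simp

definition M where "M = quotient_module (ring_as_module R) I"

definition cl :: "'a \<Rightarrow> 'a set" where "cl f = {g. g - f \<in> I}"

lemma cl_eq_iff: "cl f = cl g \<longleftrightarrow> f - g \<in> I"
proof
  assume eq: "cl f = cl g"
  have "f \<in> cl f" using I_zero by (simp add: cl_def)
  then have "f \<in> cl g" by (simp only: eq)
  then show "f - g \<in> I" by (simp add: cl_def)
next
  assume *: "f - g \<in> I"
  have "h - f \<in> I \<longleftrightarrow> h - g \<in> I" for h
    using I_add[OF _ *, of "h - f"] I_diff[OF _ *, of "h - g"] by auto
  then show "cl f = cl g" by (auto simp: cl_def)
qed

lemma coset_ring: "a_r_coset (ring_as_module R) I f = cl f"
  by (auto simp: ring_as_module_def a_r_coset_def r_coset_def cl_def intro: bexI[of _ "_ - f"])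

lemma carrier_M: "carrier M = range cl"
  by (auto simp: M_def quotient_module_def A_RCOSETS_def RCOSETS_def coset_ring[symmetric] a_r_coset_def)
    (auto simp: ring_as_module_def)

lemma zero_M: "\<zero>\<^bsub>M\<^esub> = cl 0"
  by (auto simp: M_def quotient_module_def cl_def)

lemma add_M: "cl f \<oplus>\<^bsub>M\<^esub> cl g = cl (f + g)"
proof -
  have "\<exists>a. a - f \<in> I \<and> (\<exists>b. b - g \<in> I \<and> h = a + b)" if "h - (f + g) \<in> I" for h
    using that I_zero by (intro exI[of _ f] conjI exI[of _ "h - f"]) (auto simp: algebra_simps)
  moreover have "a + b - (f + g) \<in> I" if "a - f \<in> I" "b - g \<in> I" for a b
    using I_add[OF that] by (simp add: algebra_simps)
  ultimately show ?thesis
    by (auto simp: M_def quotient_module_def set_add_def set_mult_def ring_as_module_def cl_def)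
qed

lemma smult_M: "r \<odot>\<^bsub>M\<^esub> cl f = cl (r * f)"
proof -
  have "r \<odot>\<^bsub>M\<^esub> cl f = (\<Union>m\<in>cl f. cl (r * m))"
    by (simp add: M_def quotient_module_def coset_ring) (simp add: ring_as_module_def)
  also have "cl (r * m) = cl (r * f)" if "m \<in> cl f" for m
    using that I_mult[of "m - f" r] by (simp add: cl_eq_iff) (simp add: cl_def algebra_simps)
  then have "(\<Union>m\<in>cl f. cl (r * m)) = (\<Union>m\<in>cl f. cl (r * f))" by simp
  also have "cl f \<noteq> {}" using I_zero by (auto simp: cl_def intro: exI[of _ f])
  then have "(\<Union>m\<in>cl f. cl (r * f)) = cl (r * f)" by simp
  finally show ?thesis .
qed

definition lfrac :: "'a \<Rightarrow> 'a \<Rightarrow> nat \<Rightarrow> ('a set \<times> nat) set" where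
  "lfrac s f i = fraction R M s (cl f) i"

lemma lfrac_eq: "lfrac s f i = {(cl g, j) | g j. \<exists>k. s ^ (k + j) * f - s ^ (k + i) * g \<in> I}"
proof -
  have rel: "((m, i), (n, j)) \<in> fraction_rel R M s \<longleftrightarrow>
      (\<exists>f g k. m = cl f \<and> n = cl g \<and> s ^ (k + j) * f - s ^ (k + i) * g \<in> I)" for m i n j
  proof -
    have "((m, i), (n, j)) \<in> fraction_rel R M s \<longleftrightarrow> (\<exists>f g. m = cl f \<and> n = cl g \<and>
        (\<exists>k. (s ^ (k + j)) \<odot>\<^bsub>M\<^esub> m = (s ^ (k + i)) \<odot>\<^bsub>M\<^esub> n))"
      unfolding fraction_rel_def carrier_M by auto
    also have "\<dots> \<longleftrightarrow> (\<exists>f g. m = cl f \<and> n = cl g \<and> (\<exists>k. s ^ (k + j) * f - s ^ (k + i) * g \<in> I))"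
      by (intro ex_cong1 conj_cong refl) (simp add: smult_M cl_eq_iff)
    finally show ?thesis by blast
  qed
  \<comment> \<open>The relation depends only on the residue class of the first numerator.\<close>
  have shift: "\<exists>k. s ^ (k + j) * f - s ^ (k + i) * g \<in> I"
    if "s ^ (k + j) * f' - s ^ (k + i) * g \<in> I" "cl f = cl f'" for f' g j k
  proof -
    have "s ^ (k + j) * (f - f') \<in> I" using that(2) by (intro I_mult) (simp add: cl_eq_iff)
    from I_add[OF that(1) this] show ?thesis by (intro exI[of _ k]) (simp add: algebra_simps)
  qed
  show ?thesis
  proof (rule Set.set_eqI)
    fix p :: "'a set \<times> nat"
    obtain n j where p: "p = (n, j)" by (cases p)
    show "p \<in> lfrac s f i \<longleftrightarrow> p \<in> {(cl g, j) | g j. \<exists>k. s ^ (k + j) * f - s ^ (k + i) * g \<in> I}"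
      unfolding p lfrac_def fraction_def Image_singleton_iff rel using shift by blast
  qed
qed

lemma lfrac_rel_sym:
  "s ^ (k + j) * f - s ^ (k + i) * g \<in> I \<Longrightarrow> s ^ (k + i) * g - s ^ (k + j) * f \<in> I"
  using I_minus[of "s ^ (k + j) * f - s ^ (k + i) * g"] by simp

text \<open>
  Transitivity needs \<open>j\<close> more powers of \<open>s\<close> in the exponent, because the middle denominator
  has to be cleared.
\<close>

lemma lfrac_rel_trans:
  assumes "s ^ (k + j) * f - s ^ (k + i) * g \<in> I" "s ^ (l + m) * g - s ^ (l + j) * h \<in> I"
  shows "s ^ ((k + l + j) + m) * f - s ^ ((k + l + j) + i) * h \<in> I"
proof -
  have "s ^ (l + m) * (s ^ (k + j) * f - s ^ (k + i) * g)
      + s ^ (k + i) * (s ^ (l + m) * g - s ^ (l + j) * h) \<in> I"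
    by (intro I_add I_mult assms)
  then show ?thesis by (simp add: algebra_simps power_add)
qed

lemma lfrac_eq_iff: "lfrac s f i = lfrac s g j \<longleftrightarrow> (\<exists>k. s ^ (k + j) * f - s ^ (k + i) * g \<in> I)"
proof
  assume eq: "lfrac s f i = lfrac s g j"
  have "(cl g, j) \<in> lfrac s g j" using I_zero by (auto simp: lfrac_eq intro!: exI[of _ g])
  then have "(cl g, j) \<in> lfrac s f i" by (simp only: eq)
  then obtain h k where h: "cl g = cl h" "s ^ (k + j) * f - s ^ (k + i) * h \<in> I"
    by (subst (asm) lfrac_eq) blast
  have "s ^ (k + j) * f - s ^ (k + i) * h - s ^ (k + i) * (g - h) \<in> I"
    using h by (intro I_diff[OF h(2)] I_mult) (simp add: cl_eq_iff)
  then show "\<exists>k. s ^ (k + j) * f - s ^ (k + i) * g \<in> I" by (auto simp: algebra_simps)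
next
  assume "\<exists>k. s ^ (k + j) * f - s ^ (k + i) * g \<in> I"
  then obtain k where k: "s ^ (k + j) * f - s ^ (k + i) * g \<in> I" by blast
  have sub: "lfrac s f i \<subseteq> lfrac s g j" if k: "s ^ (k + j) * f - s ^ (k + i) * g \<in> I" for f i g j k
  proof
    fix p assume "p \<in> lfrac s f i"
    then obtain h m l where p: "p = (cl h, m)" and l: "s ^ (l + m) * f - s ^ (l + i) * h \<in> I"
      by (subst (asm) lfrac_eq) blast
    have "s ^ (k + l + i + m) * g - s ^ (k + l + i + j) * h \<in> I"
      by (rule lfrac_rel_trans[OF lfrac_rel_sym[OF k] l])
    then show "p \<in> lfrac s g j" by (subst lfrac_eq) (use p in blast)
  qed
  show "lfrac s f i = lfrac s g j"
    by (rule subset_antisym[OF sub[OF k] sub[OF lfrac_rel_sym[OF k]]])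
qed

text \<open>
  The operations on a localization are unions over all representatives of a class; this
  describes what these unions range over.
\<close>

lemma lfrac_mem: "(m, j) \<in> lfrac s f i \<longleftrightarrow> (\<exists>g. m = cl g \<and> lfrac s g j = lfrac s f i)"
proof -
  have "(m, j) \<in> lfrac s f i \<longleftrightarrow> (\<exists>g. m = cl g \<and> lfrac s f i = lfrac s g j)"
    unfolding lfrac_eq_iff by (subst lfrac_eq) blast
  then show ?thesis by (metis (lifting))
qed

lemma lfrac_self: "(cl f, i) \<in> lfrac s f i" by (auto simp: lfrac_mem)

abbreviation "L s \<equiv> localization R M s"

lemma carrier_L: "carrier (L s) = {lfrac s f i | f i. True}"
  by (auto simp: localization_def lfrac_def carrier_M)

lemma zero_L: "\<zero>\<^bsub>L s\<^esub> = lfrac s 0 0"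
  by (simp add: localization_def lfrac_def zero_M)

lemma lfrac_in_L [simp]: "lfrac s f i \<in> carrier (L s)" by (auto simp: carrier_L)

lemma UNION_const_eq: "(\<And>a. a \<in> A \<Longrightarrow> F a = c) \<Longrightarrow> A \<noteq> {} \<Longrightarrow> (\<Union>a\<in>A. F a) = c"
  by auto

lemma smult_L: "r \<odot>\<^bsub>L s\<^esub> lfrac s f i = lfrac s (r * f) i"
proof -
  have "r \<odot>\<^bsub>L s\<^esub> lfrac s f i = (\<Union>p\<in>lfrac s f i. case p of (m, j) \<Rightarrow> fraction R M s (r \<odot>\<^bsub>M\<^esub> m) j)"
    by (simp add: localization_def)
  also have "\<dots> = lfrac s (r * f) i"
  proof (rule UNION_const_eq)
    fix p assume "p \<in> lfrac s f i"
    then obtain g j where p: "p = (cl g, j)" "lfrac s g j = lfrac s f i"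
      by (cases p) (auto simp: lfrac_mem)
    then obtain k where "s ^ (k + i) * g - s ^ (k + j) * f \<in> I" by (auto simp: lfrac_eq_iff)
    then have "r * (s ^ (k + i) * g - s ^ (k + j) * f) \<in> I" by (rule I_mult)
    then have "lfrac s (r * g) j = lfrac s (r * f) i"
      unfolding lfrac_eq_iff by (intro exI[of _ k]) (simp add: algebra_simps)
    then show "(case p of (m, j) \<Rightarrow> fraction R M s (r \<odot>\<^bsub>M\<^esub> m) j) = lfrac s (r * f) i"
      by (simp add: p smult_M lfrac_def)
  qed (use lfrac_self in blast)
  finally show ?thesis .
qed

lemma add_L: "lfrac s f i \<oplus>\<^bsub>L s\<^esub> lfrac s g j = lfrac s (s ^ j * f + s ^ i * g) (i + j)"
proof -
  have "lfrac s f i \<oplus>\<^bsub>L s\<^esub> lfrac s g j =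
    (\<Union>p\<in>lfrac s f i. \<Union>q\<in>lfrac s g j. case p of (m, i) \<Rightarrow> case q of (n, j) \<Rightarrow>
        fraction R M s ((s ^ j) \<odot>\<^bsub>M\<^esub> m \<oplus>\<^bsub>M\<^esub> (s ^ i) \<odot>\<^bsub>M\<^esub> n) (i + j))"
    by (auto simp: localization_def)
  also have "\<dots> = lfrac s (s ^ j * f + s ^ i * g) (i + j)"
  proof (intro UNION_const_eq)
    fix p q assume "p \<in> lfrac s f i" "q \<in> lfrac s g j"
    then obtain f' i' g' j' where pq: "p = (cl f', i')" "lfrac s f' i' = lfrac s f i"
        "q = (cl g', j')" "lfrac s g' j' = lfrac s g j"
      by (cases p, cases q) (auto simp: lfrac_mem)
    then obtain k l where "s ^ (k + i) * f' - s ^ (k + i') * f \<in> I"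
      "s ^ (l + j) * g' - s ^ (l + j') * g \<in> I" by (auto simp: lfrac_eq_iff)
    then have "s ^ (l + j + j') * (s ^ (k + i) * f' - s ^ (k + i') * f)
        + s ^ (k + i + i') * (s ^ (l + j) * g' - s ^ (l + j') * g) \<in> I"
      by (intro I_add I_mult)
    then have "lfrac s (s ^ j' * f' + s ^ i' * g') (i' + j') = lfrac s (s ^ j * f + s ^ i * g) (i + j)"
      unfolding lfrac_eq_iff by (intro exI[of _ "k + l"]) (simp add: algebra_simps power_add)
    then show "(case p of (m, i) \<Rightarrow> case q of (n, j) \<Rightarrow>
        fraction R M s ((s ^ j) \<odot>\<^bsub>M\<^esub> m \<oplus>\<^bsub>M\<^esub> (s ^ i) \<odot>\<^bsub>M\<^esub> n) (i + j))
        = lfrac s (s ^ j * f + s ^ i * g) (i + j)"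
      by (simp add: pq smult_M add_M lfrac_def)
  qed (use lfrac_self in blast)+
  finally show ?thesis .
qed

lemma map_L: "localization_map R M s y (lfrac s f i) = lfrac (s * y) (y ^ i * f) i"
proof -
  have "localization_map R M s y (lfrac s f i) =
      (\<Union>p\<in>lfrac s f i. case p of (m, i) \<Rightarrow> fraction R M (s * y) ((y ^ i) \<odot>\<^bsub>M\<^esub> m) i)"
    by (simp add: localization_map_def)
  also have "\<dots> = lfrac (s * y) (y ^ i * f) i"
  proof (rule UNION_const_eq)
    fix p assume "p \<in> lfrac s f i"
    then obtain g j where p: "p = (cl g, j)" "lfrac s g j = lfrac s f i"
      by (cases p) (auto simp: lfrac_mem)
    then obtain k where "s ^ (k + i) * g - s ^ (k + j) * f \<in> I" by (auto simp: lfrac_eq_iff)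
    then have "y ^ (k + i + j) * (s ^ (k + i) * g - s ^ (k + j) * f) \<in> I" by (rule I_mult)
    then have "lfrac (s * y) (y ^ j * g) j = lfrac (s * y) (y ^ i * f) i"
      unfolding lfrac_eq_iff
      by (intro exI[of _ k]) (simp add: algebra_simps power_add power_mult_distrib)
    then show "(case p of (m, i) \<Rightarrow> fraction R M (s * y) ((y ^ i) \<odot>\<^bsub>M\<^esub> m) i)
        = lfrac (s * y) (y ^ i * f) i"
      by (simp add: p smult_M lfrac_def)
  qed (use lfrac_self in blast)
  finally show ?thesis .
qed

lemma lfrac_expand: "lfrac s f i = lfrac s (s ^ j * f) (i + j)"
  unfolding lfrac_eq_iff using I_zero by (intro exI[of _ 0]) (simp add: algebra_simps power_add)

lemma lfrac_zero_iff: "lfrac s f i = lfrac s 0 0 \<longleftrightarrow> (\<exists>k. s ^ k * f \<in> I)"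
  unfolding lfrac_eq_iff by simp

text \<open>
  Without this, the finite sums in the Cech differential could not be evaluated.
\<close>

lemma abelian_monoid_L: "abelian_monoid (L s)"
proof (rule abelian_monoidI)
  fix A B C assume "A \<in> carrier (L s)" "B \<in> carrier (L s)" "C \<in> carrier (L s)"
  then show "(A \<oplus>\<^bsub>L s\<^esub> B) \<oplus>\<^bsub>L s\<^esub> C = A \<oplus>\<^bsub>L s\<^esub> (B \<oplus>\<^bsub>L s\<^esub> C)"
    by (auto simp: carrier_L add_L algebra_simps power_add)
qed (auto simp: carrier_L zero_L add_L algebra_simps, blast)

end

section \<open>The Cech complex in degrees 0, 1 and 2\<close>

locale cech = ring_mod_ideal I for I :: "'a::comm_ring_1 set" +
  fixes x :: "'i::{finite,linorder} \<Rightarrow> 'a"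
begin

abbreviation "index_sets p \<equiv> {S :: 'i set. S \<subseteq> UNIV \<and> card S = p}"

text \<open>
  Elements of the localization at 1 have a representative with denominator 1, and finitely many fractions have
  representatives whose denominators carry a common exponent \<open>n\<close>. So \<open>cochain0\<close> and \<open>cochain1\<close>
  reach all cochains of degrees 0 and 1.
\<close>

definition cochain0 :: "'a \<Rightarrow> 'i set \<Rightarrow> ('a set \<times> nat) set" where
  "cochain0 g = (\<lambda>S\<in>index_sets 0. lfrac 1 g 0)"

definition cochain1 :: "('i \<Rightarrow> 'a) \<Rightarrow> nat \<Rightarrow> 'i set \<Rightarrow> ('a set \<times> nat) set" where
  "cochain1 f n = (\<lambda>S\<in>index_sets 1. lfrac (prod x S) (f (the_elem S)) n)"

abbreviation "C p \<equiv> cech_module R UNIV x M p"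

lemma power_torsion_iff: "(\<exists>N. s ^ N * (s ^ n * h) \<in> I) \<longleftrightarrow> (\<exists>N. s ^ N * h \<in> I)"
proof
  assume "\<exists>N. s ^ N * (s ^ n * h) \<in> I"
  then obtain N where "s ^ N * (s ^ n * h) \<in> I" by blast
  then have "s ^ (N + n) * h \<in> I" by (simp add: power_add mult.assoc)
  then show "\<exists>N. s ^ N * h \<in> I" by blast
next
  assume "\<exists>N. s ^ N * h \<in> I"
  then obtain N where "s ^ N * h \<in> I" by blast
  from I_mult[OF this, of "s ^ n"] show "\<exists>N. s ^ N * (s ^ n * h) \<in> I"
    by (intro exI[of _ N]) (simp add: algebra_simps)
qed

lemma cech_term_eq: "cech_term R x M S = L (prod x S)"
  by (simp add: cech_term_def index_product_def)

lemma cochain1_single: "cochain1 f n {k} = lfrac (x k) (f k) n"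
  by (simp add: cochain1_def)

lemma cochain1_eq_iff:
  "cochain1 f n = cochain1 g m \<longleftrightarrow> (\<forall>k. lfrac (x k) (f k) n = lfrac (x k) (g k) m)"
proof
  assume "cochain1 f n = cochain1 g m"
  then have "cochain1 f n {k} = cochain1 g m {k}" for k by simp
  then show "\<forall>k. lfrac (x k) (f k) n = lfrac (x k) (g k) m" by (simp add: cochain1_single)
next
  assume "\<forall>k. lfrac (x k) (f k) n = lfrac (x k) (g k) m"
  then show "cochain1 f n = cochain1 g m"
    unfolding cochain1_def by (intro restrict_ext) (auto simp: card_1_singleton_iff)
qed

lemma cochain1_add:
  "cochain1 f n \<oplus>\<^bsub>C 1\<^esub> cochain1 g m = cochain1 (\<lambda>k. x k ^ m * f k + x k ^ n * g k) (n + m)"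
  unfolding cech_module_def Let_def cochain1_def
  by (auto simp: cech_term_eq card_1_singleton_iff add_L intro!: restrict_ext)

lemma cochain1_smult: "r \<odot>\<^bsub>C 1\<^esub> cochain1 f n = cochain1 (\<lambda>k. r * f k) n"
  unfolding cech_module_def Let_def cochain1_def
  by (auto simp: cech_term_eq card_1_singleton_iff smult_L intro!: restrict_ext)

lemma carrier_C0: "carrier (C 0) = range cochain0"
proof
  show "range cochain0 \<subseteq> carrier (C 0)"
    by (simp add: cech_module_def Let_def cochain0_def cech_term_eq restrict_PiE_iff image_subset_iff)
  show "carrier (C 0) \<subseteq> range cochain0"
  proof
    fix c assume "c \<in> carrier (C 0)"
    then have c: "c \<in> (\<Pi>\<^sub>E S\<in>index_sets 0. carrier (cech_term R x M S))"
      by (simp add: cech_module_def Let_def)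
    then have "c {} \<in> carrier (L 1)" by (auto simp: cech_term_eq dest!: PiE_mem[of _ _ _ "{}"])
    then obtain f i where "c {} = lfrac 1 f i" by (auto simp: carrier_L)
    also have "\<dots> = lfrac 1 f 0" using I_zero by (simp add: lfrac_eq_iff)
    finally have "c = cochain0 f"
      using c by (intro PiE_ext[OF c]) (auto simp: cochain0_def cech_term_eq)
    then show "c \<in> range cochain0" by blast
  qed
qed

lemma carrier_C1: "carrier (C 1) = {cochain1 f n | f n. True}"
proof
  show "{cochain1 f n | f n. True} \<subseteq> carrier (C 1)"
    by (auto simp: cech_module_def Let_def cochain1_def cech_term_eq)
  show "carrier (C 1) \<subseteq> {cochain1 f n | f n. True}"
  proof
    fix c assume "c \<in> carrier (C 1)"
    then have c: "c \<in> (\<Pi>\<^sub>E S\<in>index_sets 1. carrier (cech_term R x M S))"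
      by (simp add: cech_module_def Let_def)
    have "\<exists>f n. c {k} = lfrac (x k) f n" for k
      using PiE_mem[OF c, of "{k}"] by (auto simp: cech_term_eq carrier_L)
    then obtain f n where fn: "\<And>k. c {k} = lfrac (x k) (f k) (n k)" by metis
    \<comment> \<open>A common denominator exponent.\<close>
    define N where "N = Max (range n)"
    have N: "n k \<le> N" for k unfolding N_def by simp
    have "c {k} = lfrac (x k) (x k ^ (N - n k) * f k) N" for k
      using lfrac_expand[of "x k" "f k" "n k" "N - n k"] N[of k] by (simp add: fn)
    then have "c = cochain1 (\<lambda>k. x k ^ (N - n k) * f k) N"
      by (intro PiE_ext[OF c]) (auto simp: cochain1_def cech_term_eq card_1_singleton_iff)
    then show "c \<in> {cochain1 f n | f n. True}" by blast
  qed
qed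

lemma finsum_L_single: "F k \<in> carrier (L s) \<Longrightarrow> finsum (L s) F {k} = F k"
  using abelian_monoid.finsum_insert[OF abelian_monoid_L, of "{}" k F s]
    abelian_monoid.finsum_empty[OF abelian_monoid_L, of s F]
    abelian_monoid.r_zero[OF abelian_monoid_L, of "F k" s]
  by simp

lemma finsum_L_pair:
  assumes "j \<noteq> k" "F j \<in> carrier (L s)" "F k \<in> carrier (L s)"
  shows "finsum (L s) F {j, k} = F j \<oplus>\<^bsub>L s\<^esub> F k"
  using abelian_monoid.finsum_insert[OF abelian_monoid_L, of "{k}" j F s] assms
  by (simp add: finsum_L_single)

lemma differential0: "cech_differential R UNIV x M 0 (cochain0 g) = cochain1 (\<lambda>_. g) 0"
proof -
  have *: "finsum (L (x k)) (\<lambda>k'. ((-1) ^ card {j \<in> {k}. j < k'}) \<odot>\<^bsub>L (x k)\<^esub>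
            localization_map R M (prod x ({k} - {k'})) (x k') (cochain0 g ({k} - {k'}))) {k}
        = lfrac (x k) g 0" for k
  proof -
    have empty: "{j. j = k \<and> j < k} = {}" by auto
    show ?thesis by (subst finsum_L_single) (simp_all add: empty cochain0_def map_L smult_L)
  qed
  show ?thesis
    unfolding cech_differential_def cochain1_def add_0
  proof (rule restrict_ext)
    fix T :: "'i set" assume "T \<in> index_sets 1"
    then obtain k where "T = {k}" by (auto simp: card_1_singleton_iff)
    with *[of k] show "(\<Oplus>\<^bsub>cech_term R x M T\<^esub>k\<in>T.
          ((\<ominus>\<^bsub>R\<^esub> \<one>\<^bsub>R\<^esub>) [^]\<^bsub>R\<^esub> card {j \<in> T. j < k}) \<odot>\<^bsub>cech_term R x M T\<^esub>
            localization_map R M (index_product R x (T - {k})) (x k) (cochain0 g (T - {k})))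
        = lfrac (prod x T) g 0"
      by (simp add: cech_term_eq index_product_def)
  qed
qed

lemma coboundaries1: "cech_coboundaries R UNIV x M 1 = {cochain1 (\<lambda>_. g) 0 | g. True}"
  unfolding cech_coboundaries_def One_nat_def nat.case carrier_C0 image_image
  by (auto simp: differential0)

lemma differential1:
  assumes "j < k"
  shows "cech_differential R UNIV x M 1 (cochain1 f n) {j, k} =
    lfrac (x j * x k) ((x j * x k) ^ n * (x j ^ n * f k - x k ^ n * f j)) (n + n)"
proof -
  let ?G = "\<lambda>k'. ((-1) ^ card {i \<in> {j, k}. i < k'}) \<odot>\<^bsub>L (x j * x k)\<^esub>
            localization_map R M (prod x ({j, k} - {k'})) (x k') (cochain1 f n ({j, k} - {k'}))"
  have jk: "j \<noteq> k" "{j, k} - {j} = {k}" "{j, k} - {k} = {j}"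
    "{i \<in> {j, k}. i < j} = {}" "{i \<in> {j, k}. i < k} = {j}"
    using assms by auto
  have G: "?G j = lfrac (x j * x k) (x j ^ n * f k) n" "?G k = lfrac (x j * x k) (- (x k ^ n * f j)) n"
    unfolding jk by (simp_all add: cochain1_single map_L smult_L mult.commute)
  have "cech_differential R UNIV x M 1 (cochain1 f n) {j, k} = finsum (L (x j * x k)) ?G {j, k}"
    using jk(1) by (simp add: cech_differential_def cech_term_eq index_product_def)
  also have "\<dots> = ?G j \<oplus>\<^bsub>L (x j * x k)\<^esub> ?G k"
    by (rule finsum_L_pair[OF jk(1)]) (simp_all only: G lfrac_in_L)
  also have "\<dots> = lfrac (x j * x k) ((x j * x k) ^ n * (x j ^ n * f k - x k ^ n * f j)) (n + n)"
    unfolding G add_L by (simp add: algebra_simps)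
  finally show ?thesis .
qed

text \<open>
  This is the vanishing of \<open>f\<^sub>k / x\<^sub>k\<^sup>n - f\<^sub>j / x\<^sub>j\<^sup>n\<close> in the localization at \<open>x\<^sub>j x\<^sub>k\<close>.
\<close>

definition is_cocycle :: "('i \<Rightarrow> 'a) \<Rightarrow> nat \<Rightarrow> bool" where
  "is_cocycle f n \<longleftrightarrow> (\<forall>j k. \<exists>N. (x j * x k) ^ N * (x j ^ n * f k - x k ^ n * f j) \<in> I)"

lemma cocycles1_iff: "cochain1 f n \<in> cech_cocycles R UNIV x M 1 \<longleftrightarrow> is_cocycle f n"
proof -
  let ?d = "cech_differential R UNIV x M 1 (cochain1 f n)"
  have "\<zero>\<^bsub>C (1 + 1)\<^esub> = (\<lambda>T\<in>index_sets (1 + 1). lfrac (prod x T) 0 0)"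
    unfolding cech_module_def Let_def by (simp add: cech_term_eq zero_L)
  moreover have "?d \<in> extensional (index_sets (1 + 1))"
    by (simp add: cech_differential_def)
  ultimately have "cochain1 f n \<in> cech_cocycles R UNIV x M 1 \<longleftrightarrow>
      (\<forall>T\<in>index_sets (1 + 1). ?d T = lfrac (prod x T) 0 0)"
    unfolding cech_cocycles_def carrier_C1 mem_Collect_eq
    by (auto simp: fun_eq_iff extensional_def)
  also have "\<dots> \<longleftrightarrow> (\<forall>j k. j < k \<longrightarrow> ?d {j, k} = lfrac (prod x {j, k}) 0 0)" (is "?A \<longleftrightarrow> ?B")
  proof
    show "?A \<Longrightarrow> ?B" by auto
    assume B: ?B
    show ?A
    proof
      fix T :: "'i set" assume "T \<in> index_sets (1 + 1)"
      then obtain j k where "j \<noteq> k" "T = {j, k}" by (auto simp: card_2_iff numeral_2_eq_2[symmetric])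
      moreover from this have "j < k \<or> k < j" by auto
      ultimately obtain j k where "j < k" "T = {j, k}" by (metis insert_commute)
      then show "?d T = lfrac (prod x T) 0 0" using B by blast
    qed
  qed
  also have "\<dots> \<longleftrightarrow> (\<forall>j k. j < k \<longrightarrow> (\<exists>N. (x j * x k) ^ N * (x j ^ n * f k - x k ^ n * f j) \<in> I))"
  proof -
    have "?d {j, k} = lfrac (prod x {j, k}) 0 0 \<longleftrightarrow>
        (\<exists>N. (x j * x k) ^ N * (x j ^ n * f k - x k ^ n * f j) \<in> I)" if "j < k" for j k
    proof -
      have "prod x {j, k} = x j * x k" using that by auto
      then have "?d {j, k} = lfrac (prod x {j, k}) 0 0 \<longleftrightarrow>
          (\<exists>N. (x j * x k) ^ N * ((x j * x k) ^ n * (x j ^ n * f k - x k ^ n * f j)) \<in> I)"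
        unfolding differential1[OF that] by (simp add: lfrac_zero_iff)
      also have "\<dots> \<longleftrightarrow> (\<exists>N. (x j * x k) ^ N * (x j ^ n * f k - x k ^ n * f j) \<in> I)"
        by (rule power_torsion_iff)
      finally show ?thesis .
    qed
    then show ?thesis by blast
  qed
  also have "\<dots> \<longleftrightarrow> is_cocycle f n"
  proof
    assume L: "\<forall>j k. j < k \<longrightarrow> (\<exists>N. (x j * x k) ^ N * (x j ^ n * f k - x k ^ n * f j) \<in> I)"
    show "is_cocycle f n" unfolding is_cocycle_def
    proof (intro allI)
      fix j k :: 'i
      consider "j < k" | "j = k" | "k < j" by (rule linorder_cases)
      then show "\<exists>N. (x j * x k) ^ N * (x j ^ n * f k - x k ^ n * f j) \<in> I"
      proof cases
        case 3
        with L obtain N where "(x k * x j) ^ N * (x k ^ n * f j - x j ^ n * f k) \<in> I" by blast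
        from I_minus[OF this] show ?thesis by (intro exI[of _ N]) (simp add: algebra_simps)
      qed (use L I_zero in auto)
    qed
  qed (auto simp: is_cocycle_def)
  finally show ?thesis .
qed

text \<open>
  A coset of the coboundaries is represented by any cocycle in it, so an element \<open>r\<close> kills the
  cohomology if and only if it turns each cocycle \<open>f\<^sub>k / x\<^sub>k\<^sup>n\<close> into the image of one global element \<open>h\<close>.
\<close>

lemma annihilates_local_cohomology1_iff:
  "annihilates J (local_cohomology R UNIV x 1 M) \<longleftrightarrow>
    (\<forall>r\<in>J. \<forall>f n. is_cocycle f n \<longrightarrow>
       (\<exists>h. \<forall>k. \<exists>N. x k ^ N * (r * f k - x k ^ n * h) \<in> I))"
proof -
  define Z where "Z = cech_cocycles R UNIV x M 1"
  define B where "B = {cochain1 (\<lambda>_. g) 0 | g. True}"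
  define Q where "Q = (C 1)\<lparr>carrier := Z\<rparr>"
  define K where "K f n = {cochain1 (\<lambda>k. x k ^ n * g + f k) n | g. True}" for f n
  have coset: "a_r_coset Q B (cochain1 f n) = K f n" for f n
    unfolding a_r_coset_def r_coset_def K_def B_def
    by (auto simp: Q_def cochain1_add simp del: One_nat_def)
  have smult: "r \<odot>\<^bsub>Q\<^esub> cochain1 f n = cochain1 (\<lambda>k. r * f k) n" for r f n
    by (simp add: Q_def cochain1_smult del: One_nat_def)
  have "carrier (local_cohomology R UNIV x 1 M) = a_rcosets\<^bsub>Q\<^esub> B"
    by (simp add: local_cohomology_def quotient_module_def coboundaries1 Q_def B_def Z_def del: One_nat_def)
  also have "\<dots> = {a_r_coset Q B c | c. c \<in> Z}"
    by (auto simp: A_RCOSETS_def RCOSETS_def a_r_coset_def Q_def)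
  also have "\<dots> = {K f n | f n. is_cocycle f n}"
  proof -
    have "Z \<subseteq> {cochain1 f n | f n. True}"
      unfolding Z_def cech_cocycles_def carrier_C1 by auto
    then show ?thesis using cocycles1_iff coset unfolding Z_def by blast
  qed
  finally have carr: "carrier (local_cohomology R UNIV x 1 M) = {K f n | f n. is_cocycle f n}" .
  have zero: "\<zero>\<^bsub>local_cohomology R UNIV x 1 M\<^esub> = B"
    by (simp add: local_cohomology_def quotient_module_def coboundaries1 B_def del: One_nat_def)
  have smultK: "r \<odot>\<^bsub>local_cohomology R UNIV x 1 M\<^esub> K f n = K (\<lambda>k. r * f k) n" for r f n
  proof -
    \<comment> \<open>All members of a coset have the same multiple modulo coboundaries.\<close>
    have shift: "K (\<lambda>k. r * (x k ^ n * g + f k)) n = K (\<lambda>k. r * f k) n" for g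
    proof -
      have "\<exists>h'. cochain1 (\<lambda>k. x k ^ n * h + r * (x k ^ n * g + f k)) n =
           cochain1 (\<lambda>k. x k ^ n * h' + r * f k) n" for h
        by (rule exI[of _ "h + r * g"]) (simp add: algebra_simps)
      moreover have "\<exists>h'. cochain1 (\<lambda>k. x k ^ n * h + r * f k) n =
           cochain1 (\<lambda>k. x k ^ n * h' + r * (x k ^ n * g + f k)) n" for h
        by (rule exI[of _ "h - r * g"]) (simp add: algebra_simps)
      ultimately show ?thesis unfolding K_def by blast
    qed
    have "r \<odot>\<^bsub>local_cohomology R UNIV x 1 M\<^esub> K f n = (\<Union>m\<in>K f n. a_r_coset Q B (r \<odot>\<^bsub>Q\<^esub> m))"
      by (simp add: local_cohomology_def quotient_module_def coboundaries1 B_def Q_def Z_def del: One_nat_def)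
    also have "\<dots> = (\<Union>g. K (\<lambda>k. r * (x k ^ n * g + f k)) n)"
      by (auto simp: K_def[of f] smult coset)
    also have "\<dots> = K (\<lambda>k. r * f k) n" by (simp add: shift)
    finally show ?thesis .
  qed
  have KB: "K f n = B \<longleftrightarrow> (\<exists>h. \<forall>k. \<exists>N. x k ^ N * (f k - x k ^ n * h) \<in> I)" for f n
  proof -
    have "(\<exists>h. \<forall>k. \<exists>N. x k ^ N * (f k - x k ^ n * h) \<in> I) \<longleftrightarrow> (\<exists>h. cochain1 f n = cochain1 (\<lambda>_. h) 0)"
      by (simp add: cochain1_eq_iff lfrac_eq_iff algebra_simps power_add)
    also have "\<dots> \<longleftrightarrow> K f n = B"
    proof
      assume "\<exists>h. cochain1 f n = cochain1 (\<lambda>_. h) 0"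
      then obtain h where h: "cochain1 f n = cochain1 (\<lambda>_. h) 0" by blast
      have "cochain1 (\<lambda>k. x k ^ n * g + f k) n = cochain1 (\<lambda>_. g + h) 0" for g
      proof -
        have "cochain1 (\<lambda>k. x k ^ n * g + f k) n = cochain1 (\<lambda>_. g) 0 \<oplus>\<^bsub>C 1\<^esub> cochain1 f n"
          by (simp add: cochain1_add del: One_nat_def)
        also have "\<dots> = cochain1 (\<lambda>_. g + h) 0" by (simp add: h cochain1_add del: One_nat_def)
        finally show ?thesis .
      qed
      then have "K f n = {cochain1 (\<lambda>_. g + h) 0 | g. True}" by (simp add: K_def)
      also have "\<dots> = B" unfolding B_def by (metis diff_add_cancel)
      finally show "K f n = B" .
    next
      assume "K f n = B"
      moreover have "cochain1 f n \<in> K f n" unfolding K_def by (force intro: exI[of _ 0])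
      ultimately show "\<exists>h. cochain1 f n = cochain1 (\<lambda>_. h) 0" unfolding B_def by blast
    qed
    finally show ?thesis by blast
  qed
  show ?thesis
    unfolding annihilates_def carr zero KB[symmetric] smultK[symmetric] by blast
qed

end

section \<open>Powers of the ideals of the coordinate lines\<close>

lemma exhaust_idx: "k = 1 \<or> k = 2 \<or> k = 3 \<or> k = (4::4)"
proof (induct k)
  case (of_int z)
  then have "z = 0 \<or> z = 1 \<or> z = 2 \<or> z = 3" by fastforce
  then show ?case by auto
qed

lemma all_idx: "(\<forall>k::4. P k) \<longleftrightarrow> P 1 \<and> P 2 \<and> P 3 \<and> P 4"
  by (metis exhaust_idx)

lemma lookup_monomial_mult:
  fixes f :: "'m::cancel_comm_monoid_add \<Rightarrow>\<^sub>0 'k::comm_ring_1"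
  shows "Poly_Mapping.lookup (Poly_Mapping.single m 1 * f) (m + v) = Poly_Mapping.lookup f v"
  by (simp add: lookup_mult lookup_single when_mult)

lemma lookup_monomial_mult_outside:
  fixes f :: "'m::cancel_comm_monoid_add \<Rightarrow>\<^sub>0 'k::comm_ring_1"
  assumes "\<And>v. w \<noteq> m + v"
  shows "Poly_Mapping.lookup (Poly_Mapping.single m 1 * f) w = 0"
  using assms by (simp add: lookup_mult lookup_single when_mult)

lemma poly_mapping_eq_sum_monomials:
  fixes f :: "'m \<Rightarrow>\<^sub>0 'k::comm_monoid_add"
  shows "f = (\<Sum>w\<in>Poly_Mapping.keys f. Poly_Mapping.single w (Poly_Mapping.lookup f w))"
  by (rule poly_mapping_eqI)
    (simp add: lookup_sum lookup_single when_def sum.delta in_keys_iff)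

lemma xvar_power: "xvar i ^ n = Poly_Mapping.single (Poly_Mapping.single i n) (1 :: 'k::field)"
  by (induction n) (simp_all add: xvar_def mult_single single_add[symmetric] mult.commute[of _ "xvar i"])

lemma lookup_xvar_power_mult:
  "Poly_Mapping.lookup (xvar k ^ n * f) (Poly_Mapping.single k n + v) = Poly_Mapping.lookup f v"
  by (simp add: xvar_power lookup_monomial_mult)

lemma lookup_xvar_mult:
  "Poly_Mapping.lookup (xvar k * f) (Poly_Mapping.single k 1 + v) = Poly_Mapping.lookup f v"
  using lookup_xvar_power_mult[of k 1] by simp

lemma lookup_xvar_power_mult_outside:
  "Poly_Mapping.lookup w k < n \<Longrightarrow> Poly_Mapping.lookup (xvar k ^ n * f) w = 0"
  unfolding xvar_power
  by (rule lookup_monomial_mult_outside) (auto simp: lookup_add)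

lemma exponent_split:
  fixes w :: "'i \<Rightarrow>\<^sub>0 nat"
  assumes "n \<le> Poly_Mapping.lookup w k"
  obtains v where "w = Poly_Mapping.single k n + v"
proof
  show "w = Poly_Mapping.single k n + (w - Poly_Mapping.single k n)"
    by (rule poly_mapping_eqI) (use assms in \<open>auto simp: lookup_add lookup_minus lookup_single when_def\<close>)
qed

text \<open>
  The polynomials vanishing to order \<open>a\<close> along the line on which the variables \<open>i\<close> and \<open>j\<close> vanish.
\<close>

definition order_ideal :: "4 \<Rightarrow> 4 \<Rightarrow> nat \<Rightarrow> 'k::field poly4 set" where
  "order_ideal i j a = {f. \<forall>w\<in>Poly_Mapping.keys f. a \<le> Poly_Mapping.lookup w i + Poly_Mapping.lookup w j}"

lemma order_ideal_mult:
  assumes "f \<in> order_ideal i j a" "g \<in> order_ideal i j b"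
  shows "f * g \<in> order_ideal i j (a + b)"
proof -
  have "a + b \<le> Poly_Mapping.lookup (u + v) i + Poly_Mapping.lookup (u + v) j"
    if "u \<in> Poly_Mapping.keys f" "v \<in> Poly_Mapping.keys g" for u v
    using that assms by (force simp: order_ideal_def lookup_add)
  then show ?thesis using keys_mult[of f g] unfolding order_ideal_def by blast
qed

lemma order_ideal_add:
  "f \<in> order_ideal i j a \<Longrightarrow> g \<in> order_ideal i j a \<Longrightarrow> f + g \<in> order_ideal i j a"
  using keys_add[of f g] unfolding order_ideal_def by blast

lemma ideal_order_ideal: "ideal (order_ideal i j a :: 'k::field poly4 set) R"
proof (rule ideal_R_I)
  fix r f :: "'k poly4" assume "f \<in> order_ideal i j a"
  moreover have "r \<in> order_ideal i j 0" by (simp add: order_ideal_def)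
  ultimately show "r * f \<in> order_ideal i j a" using order_ideal_mult[of r i j 0 f a] by simp
qed (simp_all add: order_ideal_add, simp add: order_ideal_def)

text \<open>
  By induction on the power: a monomial of order at least \<open>n + 1\<close> along the line contains one of the two variables,
  and dividing by it leaves a monomial of order at least \<open>n\<close>, since the variables are distinct.
\<close>

lemma line_power_eq_order_ideal:
  assumes "i \<noteq> j"
  shows "line_power i j a = (order_ideal i j a :: 'k::field poly4 set)"
proof -
  interpret cring "R :: 'k poly4 ring" by (rule cring_R)
  define L :: "'k poly4 set" where "L = Idl\<^bsub>R\<^esub> {xvar i, xvar j}"
  have L: "ideal L R" unfolding L_def by (rule genideal_ideal) simp
  have var: "xvar i \<in> L" "xvar j \<in> L" unfolding L_def using genideal_self[of "{xvar i, xvar j}"] by auto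
  have "L \<subseteq> order_ideal i j 1"
    unfolding L_def
    by (rule genideal_minimal[OF ideal_order_ideal]) (auto simp: order_ideal_def xvar_def)
  then have upper: "ideal_prod R (order_ideal i j n) L \<subseteq> order_ideal i j (Suc n)" for n
  proof (intro subsetI)
    fix f assume "f \<in> ideal_prod R (order_ideal i j n) L"
    then show "f \<in> order_ideal i j (Suc n)"
    proof induction
      case (prod f g)
      then show ?case using order_ideal_mult[of f i j n g 1] \<open>L \<subseteq> _\<close> by auto
    qed (simp add: order_ideal_add)
  qed
  have lower: "order_ideal i j (Suc n) \<subseteq> ideal_prod R (order_ideal i j n) L" for n
  proof
    fix f :: "'k poly4" assume f: "f \<in> order_ideal i j (Suc n)"
    interpret prod: ideal "ideal_prod R (order_ideal i j n) L" "R :: 'k poly4 ring"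
      by (rule ideal_prod_is_ideal[OF ideal_order_ideal L])
    have zero: "0 \<in> ideal_prod R (order_ideal i j n) L"
      using additive_subgroup.zero_closed[OF prod.is_additive_subgroup] by simp
    have mono: "Poly_Mapping.single w c \<in> ideal_prod R (order_ideal i j n) L"
      if "Suc n \<le> Poly_Mapping.lookup w i + Poly_Mapping.lookup w j" for w and c :: 'k
    proof -
      have "1 \<le> Poly_Mapping.lookup w i \<or> 1 \<le> Poly_Mapping.lookup w j" using that by linarith
      then obtain l where l: "l = i \<or> l = j" "1 \<le> Poly_Mapping.lookup w l" by blast
      then obtain v where v: "w = Poly_Mapping.single l 1 + v" by (blast elim: exponent_split)
      have "Poly_Mapping.lookup w i + Poly_Mapping.lookup w j =
          Suc (Poly_Mapping.lookup v i + Poly_Mapping.lookup v j)"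
        using l(1) assms by (auto simp: v lookup_add lookup_single when_def)
      then have "Poly_Mapping.single v c \<in> order_ideal i j n"
        using that by (auto simp: order_ideal_def)
      moreover have "xvar l \<in> L" using l(1) var by blast
      ultimately have "Poly_Mapping.single v c \<otimes>\<^bsub>R\<^esub> xvar l \<in> ideal_prod R (order_ideal i j n) L"
        by (rule ideal_prod.prod)
      then show ?thesis by (simp add: v xvar_def mult_single add.commute)
    qed
    have "(\<Sum>w\<in>S. Poly_Mapping.single w (Poly_Mapping.lookup f w)) \<in> ideal_prod R (order_ideal i j n) L"
      if "finite S" "S \<subseteq> Poly_Mapping.keys f" for S
      using that
    proof (induction S rule: finite_induct)
      case (insert w S)
      have "Poly_Mapping.single w (Poly_Mapping.lookup f w) \<in> ideal_prod R (order_ideal i j n) L"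
        using insert.prems f by (intro mono) (auto simp: order_ideal_def)
      moreover have "(\<Sum>w\<in>S. Poly_Mapping.single w (Poly_Mapping.lookup f w)) \<in> ideal_prod R (order_ideal i j n) L"
        using insert by blast
      ultimately have "Poly_Mapping.single w (Poly_Mapping.lookup f w) \<oplus>\<^bsub>R\<^esub>
          (\<Sum>w\<in>S. Poly_Mapping.single w (Poly_Mapping.lookup f w)) \<in> ideal_prod R (order_ideal i j n) L"
        by (rule ideal_prod.sum)
      then show ?case using insert by simp
    qed (simp add: zero)
    from this[of "Poly_Mapping.keys f"] show "f \<in> ideal_prod R (order_ideal i j n) L"
      by (simp add: poly_mapping_eq_sum_monomials[symmetric])
  qed
  have "rec_nat UNIV (\<lambda>_ J. ideal_prod R J L) a = order_ideal i j a"
  proof (induction a)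
    case (Suc n) then show ?case using upper[of n] lower[of n] by auto
  qed (simp add: order_ideal_def)
  then show ?thesis
    by (simp add: line_power_def ideal_power_def nat_pow_def ideals_set_def L_def)
qed

definition line_weight :: "nat \<Rightarrow> nat \<Rightarrow> nat \<Rightarrow> nat \<Rightarrow> nat \<Rightarrow> nat \<Rightarrow> 4 \<Rightarrow> 4 \<Rightarrow> nat" where
  "line_weight a1 a2 a3 a4 a5 a6 i j =
    (if {i, j} = {1, 2} then a1 else if {i, j} = {1, 3} then a2 else if {i, j} = {1, 4} then a3
     else if {i, j} = {2, 3} then a4 else if {i, j} = {2, 4} then a5 else a6)"

definition weight_ideal :: "(4 \<Rightarrow> 4 \<Rightarrow> nat) \<Rightarrow> 'k::field poly4 set" where
  "weight_ideal \<alpha> = {f. \<forall>w\<in>Poly_Mapping.keys f. \<forall>i j. i \<noteq> j \<longrightarrow>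
     \<alpha> i j \<le> Poly_Mapping.lookup w i + Poly_Mapping.lookup w j}"

lemma line_weight_simps:
  fixes a1 a2 a3 a4 a5 a6 :: nat
  defines "\<alpha> \<equiv> line_weight a1 a2 a3 a4 a5 a6"
  shows "\<alpha> 1 2 = a1" "\<alpha> 1 3 = a2" "\<alpha> 1 4 = a3" "\<alpha> 2 3 = a4" "\<alpha> 2 4 = a5" "\<alpha> 3 4 = a6"
    "\<alpha> 2 1 = a1" "\<alpha> 3 1 = a2" "\<alpha> 4 1 = a3" "\<alpha> 3 2 = a4" "\<alpha> 4 2 = a5" "\<alpha> 4 3 = a6"
  by (simp_all add: \<alpha>_def line_weight_def doubleton_eq_iff)

lemma line_weight_commute: "line_weight a1 a2 a3 a4 a5 a6 i j = line_weight a1 a2 a3 a4 a5 a6 j i"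
  by (simp add: line_weight_def insert_commute)

lemma tetrahedral_ideal_eq:
  "tetrahedral_ideal a1 a2 a3 a4 a5 a6 = weight_ideal (line_weight a1 a2 a3 a4 a5 a6)"
  unfolding tetrahedral_ideal_def weight_ideal_def all_idx
  by (auto simp: line_power_eq_order_ideal order_ideal_def line_weight_simps add.commute)

section \<open>The graph of an exponent vector and the first local cohomology\<close>

text \<open>
  With four vertices, a pair of distinct vertices determines its complement. This and the next lemma let the
  arguments below speak of \<open>distinct [i, m, j, k]\<close> instead of enumerating indices.
\<close>

lemma distinct4_cover:
  fixes i m j k z :: 4
  assumes "distinct [i, m, j, k]"
  shows "z = i \<or> z = m \<or> z = j \<or> z = k"
proof -
  have "card {i, m, j, k} = card (UNIV :: 4 set)" using assms by simp
  then have "{i, m, j, k} = UNIV" by (intro card_subset_eq) auto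
  then show ?thesis by auto
qed

lemma distinct4_extend:
  fixes i m k :: 4
  assumes "distinct [i, m, k]"
  obtains j where "distinct [i, m, j, k]"
proof -
  have "card {i, m, k} = 3" using assms by simp
  then have "{i, m, k} \<noteq> UNIV" by (metis card_num1 card_bit0 numeral_eq_iff semiring_norm mult.right_neutral numeral_Bit0_eq_double)
  then obtain j where "j \<notin> {i, m, k}" by blast
  then show thesis using assms by (intro that[of j]) auto
qed

text \<open>
  The weight \<open>\<alpha> i j\<close> is the multiplicity of the line with ideal \<open>(x\<^sub>i, x\<^sub>j)\<close>. The multiplicities
  enter only through the graph \<open>edge w\<close> of the pairs whose inequality fails at the exponent vector \<open>w\<close>.
\<close>

locale tetrahedral =
  fixes \<alpha> :: "4 \<Rightarrow> 4 \<Rightarrow> nat" and I :: "'k::field poly4 set"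
  assumes weight_commute: "\<alpha> i j = \<alpha> j i"
    and I_def: "I = weight_ideal \<alpha>"
begin

definition edge :: "(4 \<Rightarrow>\<^sub>0 nat) \<Rightarrow> 4 \<Rightarrow> 4 \<Rightarrow> bool" where
  "edge w i j \<longleftrightarrow> i \<noteq> j \<and> Poly_Mapping.lookup w i + Poly_Mapping.lookup w j < \<alpha> i j"

lemma edge_sym: "edge w i j \<longleftrightarrow> edge w j i"
  by (auto simp: edge_def weight_commute add.commute)

lemma edge_add: "edge (u + w) i j \<Longrightarrow> edge w i j"
  by (auto simp: edge_def lookup_add)

lemma edge_single_add: "i \<noteq> k \<Longrightarrow> j \<noteq> k \<Longrightarrow> edge (Poly_Mapping.single k n + w) i j \<longleftrightarrow> edge w i j"
  by (auto simp: edge_def lookup_add lookup_single)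

lemma mem_I_iff: "f \<in> I \<longleftrightarrow> (\<forall>w i j. edge w i j \<longrightarrow> Poly_Mapping.lookup f w = 0)"
  unfolding I_def weight_ideal_def edge_def Ball_def mem_Collect_eq in_keys_iff not_le[symmetric] by blast

lemma ideal_I: "ideal I R"
proof (rule ideal_R_I)
  fix r f assume f: "f \<in> I"
  have "w \<notin> Poly_Mapping.keys (r * f)" if "edge w i j" for w i j
  proof
    assume "w \<in> Poly_Mapping.keys (r * f)"
    then obtain u v where w: "w = u + v" "v \<in> Poly_Mapping.keys f" using keys_mult[of r f] by blast
    then have "edge v i j" using that edge_add by blast
    then show False using f w(2) by (auto simp: mem_I_iff in_keys_iff)
  qed
  then show "r * f \<in> I" by (auto simp: mem_I_iff in_keys_iff)
qed (auto simp: mem_I_iff lookup_add)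

sublocale cech I "xvar :: 4 \<Rightarrow> 'k poly4"
  by intro_locales (rule ring_mod_ideal.intro[OF ideal_I])

text \<open>
  Multiplying by powers of \<open>x\<^sub>j\<close> and \<open>x\<^sub>k\<close> moves \<open>w\<close> only in the directions \<open>j\<close> and \<open>k\<close>.
  It therefore keeps the edge between the other two vertices, and the exponent stays outside the ideal.
\<close>

lemma cocycle_lookup_eq:
  assumes f: "is_cocycle f n" and d: "distinct [i, m, j, k]" and e: "edge w i m"
  shows "Poly_Mapping.lookup (xvar j ^ n * f k) w = Poly_Mapping.lookup (xvar k ^ n * f j) w"
proof -
  from f obtain N where N: "(xvar j * xvar k) ^ N * (xvar j ^ n * f k - xvar k ^ n * f j) \<in> I"
    unfolding is_cocycle_def by blast
  have "edge (Poly_Mapping.single j N + (Poly_Mapping.single k N + w)) i m"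
    using d e by (simp add: edge_single_add)
  then have "Poly_Mapping.lookup ((xvar j * xvar k) ^ N * (xvar j ^ n * f k - xvar k ^ n * f j))
      (Poly_Mapping.single j N + (Poly_Mapping.single k N + w)) = 0"
    using N unfolding mem_I_iff by blast
  then have "Poly_Mapping.lookup (xvar j ^ n * f k - xvar k ^ n * f j) w = 0"
    by (simp only: power_mult_distrib mult.assoc lookup_xvar_power_mult)
  then show ?thesis by (simp add: lookup_minus)
qed

lemma cocycle_coeff_eq:
  assumes f: "is_cocycle f n" and d: "distinct [i, m, j, k]" and e: "edge u i m"
  shows "Poly_Mapping.lookup (f j) (Poly_Mapping.single j n + u)
       = Poly_Mapping.lookup (f k) (Poly_Mapping.single k n + u)"
proof -
  have "edge (Poly_Mapping.single j n + (Poly_Mapping.single k n + u)) i m"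
    using d e by (simp add: edge_single_add)
  note cocycle_lookup_eq[OF f d this]
  moreover have "Poly_Mapping.lookup (xvar j ^ n * f k) (Poly_Mapping.single j n + (Poly_Mapping.single k n + u))
      = Poly_Mapping.lookup (f k) (Poly_Mapping.single k n + u)"
    by (rule lookup_xvar_power_mult)
  moreover have "Poly_Mapping.lookup (xvar k ^ n * f j) (Poly_Mapping.single j n + (Poly_Mapping.single k n + u))
      = Poly_Mapping.lookup (f j) (Poly_Mapping.single j n + u)"
    by (subst add.left_commute) (rule lookup_xvar_power_mult)
  ultimately show ?thesis by simp
qed

text \<open>
  In the cocycle relation with the fourth vertex \<open>j\<close>, the term \<open>x\<^sub>k\<^sup>n f\<^sub>j\<close> has no monomial whose exponent
  at \<open>k\<close> is below \<open>n\<close>. This is the vanishing of the cohomology in degrees that are negative at \<open>k\<close>.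
\<close>

lemma cocycle_coeff_zero:
  assumes f: "is_cocycle f n" and d: "distinct [i, m, k]" and e: "edge w i m"
    and "Poly_Mapping.lookup w k < n"
  shows "Poly_Mapping.lookup (f k) w = 0"
proof -
  obtain j where j: "distinct [i, m, j, k]" using distinct4_extend[OF d] .
  have "edge (Poly_Mapping.single j n + w) i m"
    using j e by (simp add: edge_single_add)
  from cocycle_lookup_eq[OF f j this]
  have "Poly_Mapping.lookup (f k) w = Poly_Mapping.lookup (xvar k ^ n * f j) (Poly_Mapping.single j n + w)"
    by (simp only: lookup_xvar_power_mult)
  also have "\<dots> = 0"
    using assms j by (intro lookup_xvar_power_mult_outside) (auto simp: lookup_add lookup_single)
  finally show ?thesis .
qed

lemma is_cocycle_mult: "is_cocycle f n \<Longrightarrow> is_cocycle (\<lambda>k. r * f k) n"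
  unfolding is_cocycle_def
proof (intro allI)
  fix j k assume "\<forall>j k. \<exists>N. (xvar j * xvar k) ^ N * (xvar j ^ n * f k - xvar k ^ n * f j) \<in> I"
  then obtain N where "(xvar j * xvar k) ^ N * (xvar j ^ n * f k - xvar k ^ n * f j) \<in> I" by blast
  from I_mult[OF this, of r]
  show "\<exists>N. (xvar j * xvar k) ^ N * (xvar j ^ n * (r * f k) - xvar k ^ n * (r * f j)) \<in> I"
    by (intro exI[of _ N]) (simp add: algebra_simps)
qed

definition exact_matching :: "(4 \<Rightarrow>\<^sub>0 nat) \<Rightarrow> 4 \<Rightarrow> 4 \<Rightarrow> 4 \<Rightarrow> 4 \<Rightarrow> bool" where
  "exact_matching w i m j k \<longleftrightarrow> distinct [i, m, j, k] \<and> edge w i m \<and> edge w j k \<and>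
     \<not> edge w i j \<and> \<not> edge w i k \<and> \<not> edge w m j \<and> \<not> edge w m k"

text \<open>
  Two opposite edges join the four vertices into two classes of equal values, and any further edge merges
  these classes.
\<close>

lemma coeffs_equal_if_crossing:
  assumes d: "distinct [i, m, j, k]" and e: "edge w i m" "edge w j k"
    and cross: "edge w i j \<or> edge w i k \<or> edge w m j \<or> edge w m k"
    and c: "\<And>i m j k. distinct [i, m, j, k] \<Longrightarrow> edge w i m \<Longrightarrow> c j = c k"
  shows "c z = c z'"
proof -
  have "c j = c k" "c i = c m" using c[of i m j k] c[of j k i m] d e by auto
  moreover have "c i = c j \<or> c i = c k \<or> c m = c j \<or> c m = c k"
    using cross c[of i j m k] c[of i k m j] c[of m j i k] c[of m k i j] d by auto
  ultimately show ?thesis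
    using distinct4_cover[OF d, of z] distinct4_cover[OF d, of z'] by auto
qed

text \<open>
  The graph of complements of the edges of \<open>G\<^sub>w\<close> lives on the vertices that some edge avoids. Any graph on
  at most four vertices without isolated vertices is connected unless it consists of two disjoint edges, and the values
  \<open>c\<close> are constant on its components.
\<close>

lemma coeffs_equal_or_exact_matching:
  assumes c: "\<And>i m j k. distinct [i, m, j, k] \<Longrightarrow> edge w i m \<Longrightarrow> c j = c k"
    and e: "edge w i m" "k \<noteq> i" "k \<noteq> m" and e': "edge w i' m'" "k' \<noteq> i'" "k' \<noteq> m'"
  shows "c k = c k' \<or> (\<exists>i m j k. exact_matching w i m j k)"
proof (rule disjCI)
  assume no: "\<nexists>i m j k. exact_matching w i m j k"
  have "distinct [i, m, k]" using e by (auto simp: edge_def)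
  then obtain j where d: "distinct [i, m, j, k]" by (rule distinct4_extend)
  have jk: "c j = c k" using c[OF d] e by blast
  have im: "c i = c m" if "edge w j k" using c[of j k i m] d that by auto
  have full: "c k = c k'" if "edge w j k"
  proof (rule coeffs_equal_if_crossing[OF d e(1) that _ c])
    show "edge w i j \<or> edge w i k \<or> edge w m j \<or> edge w m k"
      using no d e(1) that unfolding exact_matching_def by blast
  qed
  have side: "c i = c k" if "edge w m j \<or> edge w m k"
    using that c[of m j i k] c[of m k i j] d jk by auto
  have side': "c m = c k" if "edge w i j \<or> edge w i k"
    using that c[of i j m k] c[of i k m j] d jk by auto
  show "c k = c k'"
    using e' distinct4_cover[OF d, of k'] distinct4_cover[OF d, of i'] distinct4_cover[OF d, of m']
      jk full side side' edge_sym[of w] by (metis edge_def)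
qed

text \<open>
  The coefficient at \<open>u\<close> of the required polynomial \<open>h\<close> must be the common value of
  \<open>x\<^sub>l f\<^sub>k / x\<^sub>k\<^sup>n\<close> over those \<open>k\<close> that some edge of \<open>G\<^sub>u\<close> avoids. It is well defined by connectivity,
  except when \<open>G\<^sub>u\<close> is an exact matching. Then either \<open>u\<close> vanishes at \<open>l\<close> and all values are zero, or \<open>u - e\<^sub>l\<close>
  is an exponent whose graph contains that of \<open>u\<close> and, by hypothesis, one more edge, so that already the values of
  \<open>f\<close> agree there.
\<close>

lemma xvar_mult_cocycle_is_coboundary:
  fixes f :: "4 \<Rightarrow> 'k poly4"
  assumes no: "\<And>u i m j k. exact_matching u i m j k \<Longrightarrow> \<not> exact_matching (Poly_Mapping.single l 1 + u) i m j k"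
    and f: "is_cocycle f n"
  shows "\<exists>h. \<forall>k. \<exists>N. xvar k ^ N * (xvar l * f k - xvar k ^ n * h) \<in> I"
proof -
  define f' where "f' k = xvar l * f k" for k
  define c where "c u k = Poly_Mapping.lookup (f' k) (Poly_Mapping.single k n + u)" for u k
  define avoided where "avoided u k \<longleftrightarrow> (\<exists>i m. edge u i m \<and> k \<noteq> i \<and> k \<noteq> m)" for u k
  have f': "is_cocycle f' n" unfolding f'_def by (rule is_cocycle_mult[OF f])
  have c_eq: "c u j = c u k" if "distinct [i, m, j, k]" "edge u i m" for u i m j k
    unfolding c_def using cocycle_coeff_eq[OF f' that] .
  \<comment> \<open>The only degrees in which connectivity of the graph does not help.\<close>
  have c_matching: "c u z = c u z'" if mat: "exact_matching u i m j k" for u i m j k z z'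
  proof (cases "Poly_Mapping.lookup u l = 0")
    case True
    have zero: "c u z = 0" if "z \<noteq> l" for z
      unfolding c_def f'_def using True that
      by (intro lookup_xvar_power_mult_outside[of _ l 1, simplified])
        (simp add: lookup_add lookup_single)
    have d: "distinct [i, m, j, k]" and e: "edge u i m" "edge u j k" using mat by (auto simp: exact_matching_def)
    have "c u i = c u m" "c u j = c u k" using c_eq[of i m j k u] c_eq[of j k i m u] d e by auto
    then have "c u l = 0" using distinct4_cover[OF d, of l] zero d by auto
    then show ?thesis using zero by metis
  next
    case False
    then obtain v where v: "u = Poly_Mapping.single l 1 + v"
      using exponent_split[of 1 u l] by (metis less_one linorder_not_less)
    define cv where "cv z = Poly_Mapping.lookup (f z) (Poly_Mapping.single z n + v)" for z
    have cu: "c u z = cv z" for z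
      unfolding c_def f'_def cv_def v
      by (simp only: add.left_commute[of "Poly_Mapping.single z n"] lookup_xvar_mult)
    have d: "distinct [i, m, j, k]" and e: "edge v i m" "edge v j k"
      using mat edge_add by (auto simp: exact_matching_def v)
    have "\<not> exact_matching v i m j k" using no mat unfolding v by blast
    then have "edge v i j \<or> edge v i k \<or> edge v m j \<or> edge v m k"
      using d e by (auto simp: exact_matching_def)
    then have "cv z = cv z'"
      by (rule coeffs_equal_if_crossing[OF d e]) (auto simp: cv_def intro: cocycle_coeff_eq[OF f])
    then show ?thesis by (simp add: cu)
  qed
  have c_avoided: "c u k = c u k'" if "avoided u k" "avoided u k'" for u k k'
  proof -
    from that obtain i m i' m' where e: "edge u i m" "k \<noteq> i" "k \<noteq> m" "edge u i' m'" "k' \<noteq> i'" "k' \<noteq> m'"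
      unfolding avoided_def by blast
    have "c u k = c u k' \<or> (\<exists>i m j k. exact_matching u i m j k)"
      by (rule coeffs_equal_or_exact_matching[where c = "c u", OF _ e]) (rule c_eq)
    then show ?thesis using c_matching by blast
  qed
  \<comment> \<open>Where no fraction sees \<open>u\<close>, the coefficient 0 keeps the support finite.\<close>
  define h0 where "h0 u = (if \<exists>k. avoided u k then c u (SOME k. avoided u k) else 0)" for u
  have "finite {u. h0 u \<noteq> 0}"
  proof (rule finite_subset)
    show "{u. h0 u \<noteq> 0} \<subseteq> (\<Union>k. (+) (Poly_Mapping.single k n) -` Poly_Mapping.keys (f' k))"
      by (auto simp: h0_def c_def in_keys_iff split: if_splits)
    show "finite (\<Union>k. (+) (Poly_Mapping.single k n) -` Poly_Mapping.keys (f' k))"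
      by (intro finite_UN_I finite_vimageI) (auto intro: inj_onI)
  qed
  define h where "h = Abs_poly_mapping h0"
  have lookup_h: "Poly_Mapping.lookup h u = c u k" if "avoided u k" for u k
  proof -
    have "avoided u (SOME k. avoided u k)" using that by (rule someI)
    then have "c u (SOME k. avoided u k) = c u k" using c_avoided that by blast
    then show ?thesis using that \<open>finite _\<close> by (auto simp: h_def h0_def)
  qed
  define N where "N = Max (range (\<lambda>(i, j). \<alpha> i j))"
  have N: "\<alpha> i j \<le> N" for i j
    unfolding N_def by (intro Max_ge) (auto intro: rev_image_eqI[of "(i, j)"])
  have "xvar k ^ N * (f' k - xvar k ^ n * h) \<in> I" for k
    unfolding mem_I_iff
  proof (intro allI impI)
    fix w i m assume e: "edge w i m"
    show "Poly_Mapping.lookup (xvar k ^ N * (f' k - xvar k ^ n * h)) w = 0"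
    proof (cases "Poly_Mapping.lookup w k < N")
      case False
      then obtain v where v: "w = Poly_Mapping.single k N + v"
        using exponent_split[of N w k] by (metis linorder_not_less)
      have ki: "k \<noteq> i" "k \<noteq> m" using e False N[of i m] by (auto simp: edge_def)
      then have ev: "edge v i m" using e v edge_add by blast
      have dist: "distinct [i, m, k]" using ki e by (auto simp: edge_def)
      have "Poly_Mapping.lookup (f' k) v = Poly_Mapping.lookup (xvar k ^ n * h) v"
      proof (cases "Poly_Mapping.lookup v k < n")
        case True
        then show ?thesis
          using cocycle_coeff_zero[OF f' dist ev True] lookup_xvar_power_mult_outside[OF True] by simp
      next
        case False
        then obtain u where u: "v = Poly_Mapping.single k n + u"
          using exponent_split[of n v k] by (metis linorder_not_less)
        then have "avoided u k" unfolding avoided_def using ev edge_add ki by blast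
        then show ?thesis by (simp add: u lookup_xvar_power_mult lookup_h c_def)
      qed
      then show ?thesis by (simp add: v lookup_xvar_power_mult lookup_minus)
    qed (rule lookup_xvar_power_mult_outside)
  qed
  then show ?thesis unfolding f'_def by blast
qed

text \<open>
  The cocycle is \<open>x\<^sup>u\<close> at the two ends of one edge and 0 at the ends of the other. No edge joins the two
  pairs, so the difference of these values dies in the localizations that compare them. After multiplication by \<open>x\<^sub>l\<close> a
  polynomial inducing the result would have coefficient both 1 and 0 at \<open>u + e\<^sub>l\<close>.
\<close>

lemma xvar_mult_cocycle_not_coboundary:
  assumes u: "exact_matching u i m j k" and ul: "exact_matching (Poly_Mapping.single l 1 + u) i m j k"
  obtains f :: "4 \<Rightarrow> 'k poly4" where "is_cocycle f 0"
    "\<nexists>h. \<forall>k. \<exists>N. xvar k ^ N * (xvar l * f k - xvar k ^ 0 * h) \<in> I"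
proof
  let ?X = "Poly_Mapping.single u (1 :: 'k)"
  define f where "f z = (if z = i \<or> z = m then ?X else 0)" for z
  have d: "distinct [i, m, j, k]" and non: "\<not> edge u i j" "\<not> edge u i k" "\<not> edge u m j" "\<not> edge u m k"
    and el: "edge (Poly_Mapping.single l 1 + u) i m" "edge (Poly_Mapping.single l 1 + u) j k"
    using u ul by (auto simp: exact_matching_def)
  define N where "N = Max (range (\<lambda>(i, j). \<alpha> i j))"
  have N: "\<alpha> i j \<le> N" for i j
    unfolding N_def by (intro Max_ge) (auto intro: rev_image_eqI[of "(i, j)"])
  \<comment> \<open>For large \<open>N\<close> only the pair complementary to \<open>a, b\<close> could keep the product out of the ideal.\<close>
  have cross: "(xvar a * xvar b) ^ N * ?X \<in> I" if ab: "a \<in> {i, m}" "b \<in> {j, k}" for a b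
    unfolding mem_I_iff
  proof (intro allI impI)
    fix w p q assume e: "edge w p q"
    let ?w = "Poly_Mapping.single a N + (Poly_Mapping.single b N + u)"
    have "w \<noteq> ?w"
    proof
      assume w: "w = ?w"
      have "p \<notin> {a, b}" "q \<notin> {a, b}"
        using e N[of p q] unfolding w edge_def by (auto simp: lookup_add)
      moreover from this have "edge u p q" using e edge_add unfolding w by blast
      moreover have "p \<noteq> q" using e by (simp add: edge_def)
      ultimately show False
        using ab non distinct4_cover[OF d, of p] distinct4_cover[OF d, of q] edge_sym[of u] by auto
    qed
    moreover have "(xvar a * xvar b) ^ N * ?X = Poly_Mapping.single ?w 1"
      by (simp add: power_mult_distrib xvar_power mult_single add.assoc)
    ultimately show "Poly_Mapping.lookup ((xvar a * xvar b) ^ N * ?X) w = 0"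
      by (simp add: lookup_single)
  qed
  show "is_cocycle f 0"
    unfolding is_cocycle_def
  proof (intro allI)
    fix a b
    show "\<exists>N. (xvar a * xvar b) ^ N * (xvar a ^ 0 * f b - xvar b ^ 0 * f a) \<in> I"
    proof (cases "a \<in> {i, m} \<longleftrightarrow> b \<in> {i, m}")
      case True
      then have "f a = f b" by (auto simp: f_def)
      then show ?thesis using I_zero by simp
    next
      case False
      then consider "a \<in> {i, m}" "b \<in> {j, k}" | "b \<in> {i, m}" "a \<in> {j, k}"
        using distinct4_cover[OF d, of a] distinct4_cover[OF d, of b] by blast
      then show ?thesis
      proof cases
        case 1
        then have "f a = ?X" "f b = 0" using d by (auto simp: f_def)
        then show ?thesis using I_minus[OF cross[OF 1]] by (intro exI[of _ N]) simp
      next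
        case 2
        then have "f b = ?X" "f a = 0" using d by (auto simp: f_def)
        then show ?thesis using cross[OF 2] by (intro exI[of _ N]) (simp add: mult.commute)
      qed
    qed
  qed
  show "\<nexists>h. \<forall>k. \<exists>N. xvar k ^ N * (xvar l * f k - xvar k ^ 0 * h) \<in> I"
  proof
    assume "\<exists>h. \<forall>k. \<exists>N. xvar k ^ N * (xvar l * f k - xvar k ^ 0 * h) \<in> I"
    then obtain h where h: "\<And>z. \<exists>N. xvar z ^ N * (xvar l * f z - h) \<in> I" by auto
    let ?u = "Poly_Mapping.single l 1 + u"
    have lookup: "Poly_Mapping.lookup (xvar l * f z) ?u = Poly_Mapping.lookup h ?u"
      if e: "edge ?u p q" "z \<noteq> p" "z \<noteq> q" for z p q
    proof -
      obtain N where "xvar z ^ N * (xvar l * f z - h) \<in> I" using h by blast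
      moreover have "edge (Poly_Mapping.single z N + ?u) p q" using e by (simp add: edge_single_add)
      ultimately have "Poly_Mapping.lookup (xvar z ^ N * (xvar l * f z - h)) (Poly_Mapping.single z N + ?u) = 0"
        unfolding mem_I_iff by blast
      then show ?thesis by (simp only: lookup_xvar_power_mult lookup_minus right_minus_eq)
    qed
    have "Poly_Mapping.lookup (xvar l * f i) ?u = Poly_Mapping.lookup (xvar l * f j) ?u"
      using lookup[OF el(2), of i] lookup[OF el(1), of j] d by auto
    then show False using d unfolding lookup_xvar_mult by (auto simp: f_def)
  qed
qed

definition kills :: "'k poly4 \<Rightarrow> bool" where
  "kills r \<longleftrightarrow> (\<forall>f n. is_cocycle f n \<longrightarrow> (\<exists>h. \<forall>k. \<exists>N. xvar k ^ N * (r * f k - xvar k ^ n * h) \<in> I))"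

text \<open>
  The annihilator is an ideal, hence it contains the maximal ideal as soon as it contains the variables.
\<close>

lemma ideal_kills: "ideal {r. kills r} R"
proof (rule ideal_R_I; unfold mem_Collect_eq)
  show "kills 0" unfolding kills_def using I_zero by (auto intro!: exI[of _ 0])
  fix r s assume r: "kills r"
  { assume s: "kills s"
    show "kills (r + s)" unfolding kills_def
    proof (intro allI impI)
      fix f n assume f: "is_cocycle f n"
      obtain h where h: "\<And>k. \<exists>N. xvar k ^ N * (r * f k - xvar k ^ n * h) \<in> I"
        using r f unfolding kills_def by blast
      obtain h' where h': "\<And>k. \<exists>N. xvar k ^ N * (s * f k - xvar k ^ n * h') \<in> I"
        using s f unfolding kills_def by blast
      have "\<exists>N. xvar k ^ N * ((r + s) * f k - xvar k ^ n * (h + h')) \<in> I" for k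
      proof -
        obtain N N' where "xvar k ^ N * (r * f k - xvar k ^ n * h) \<in> I"
          "xvar k ^ N' * (s * f k - xvar k ^ n * h') \<in> I" using h h' by blast
        then have "xvar k ^ N' * (xvar k ^ N * (r * f k - xvar k ^ n * h))
            + xvar k ^ N * (xvar k ^ N' * (s * f k - xvar k ^ n * h')) \<in> I"
          by (rule I_add[OF I_mult I_mult])
        then show ?thesis by (intro exI[of _ "N + N'"]) (simp add: algebra_simps power_add)
      qed
      then show "\<exists>h. \<forall>k. \<exists>N. xvar k ^ N * ((r + s) * f k - xvar k ^ n * h) \<in> I" by blast
    qed }
  show "kills (s * r)" unfolding kills_def
  proof (intro allI impI)
    fix f n assume f: "is_cocycle f n"
    obtain h where h: "\<And>k. \<exists>N. xvar k ^ N * (r * f k - xvar k ^ n * h) \<in> I"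
      using r f unfolding kills_def by blast
    have "\<exists>N. xvar k ^ N * (s * r * f k - xvar k ^ n * (s * h)) \<in> I" for k
    proof -
      obtain N where "xvar k ^ N * (r * f k - xvar k ^ n * h) \<in> I" using h by blast
      from I_mult[OF this, of s] show ?thesis by (intro exI[of _ N]) (simp add: algebra_simps)
    qed
    then show "\<exists>h. \<forall>k. \<exists>N. xvar k ^ N * (s * r * f k - xvar k ^ n * h) \<in> I" by blast
  qed
qed

lemma annihilates_H1_m_iff: "annihilates J (H1_m I) \<longleftrightarrow> (\<forall>r\<in>J. kills r)"
  unfolding H1_m_def M_def[symmetric] annihilates_local_cohomology1_iff kills_def ..

lemma annihilates_max_ideal_iff:
  "annihilates max_ideal (H1_m I) \<longleftrightarrow>
    (\<nexists>u l i m j k. exact_matching u i m j k \<and> exact_matching (Poly_Mapping.single l 1 + u) i m j k)"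
proof -
  interpret R: cring "R :: 'k poly4 ring" by (rule cring_R)
  have "annihilates max_ideal (H1_m I) \<longleftrightarrow> (\<forall>l. kills (xvar l))"
  proof
    assume "annihilates max_ideal (H1_m I)"
    moreover have "{xvar 1, xvar 2, xvar 3, xvar 4} \<subseteq> (max_ideal :: 'k poly4 set)"
      unfolding max_ideal_def by (rule R.genideal_self) simp
    ultimately show "\<forall>l. kills (xvar l)" by (simp add: annihilates_H1_m_iff all_idx)
  next
    assume "\<forall>l. kills (xvar l)"
    then have "max_ideal \<subseteq> {r. kills r}"
      unfolding max_ideal_def by (intro R.genideal_minimal ideal_kills) auto
    then show "annihilates max_ideal (H1_m I)" by (auto simp: annihilates_H1_m_iff)
  qed
  also have "\<dots> \<longleftrightarrow> (\<nexists>u l i m j k. exact_matching u i m j k \<and> exact_matching (Poly_Mapping.single l 1 + u) i m j k)"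
  proof
    assume kills: "\<forall>l. kills (xvar l)"
    show "\<nexists>u l i m j k. exact_matching u i m j k \<and> exact_matching (Poly_Mapping.single l 1 + u) i m j k"
      by (metis xvar_mult_cocycle_not_coboundary kills kills_def)
  next
    assume "\<nexists>u l i m j k. exact_matching u i m j k \<and> exact_matching (Poly_Mapping.single l 1 + u) i m j k"
    then show "\<forall>l. kills (xvar l)"
      unfolding kills_def using xvar_mult_cocycle_is_coboundary by blast
  qed
  finally show ?thesis .
qed

end

section \<open>Lattice points satisfying the matching inequalities\<close>

text \<open>
  Fourier-Motzkin elimination. For a given \<open>u\<close>, a suitable \<open>v\<close> exists if and only if each lower bound for
  \<open>v\<close> is at most each upper bound; this leaves bounds on \<open>u\<close> and on \<open>2 u\<close>. The least admissible \<open>u\<close> involves a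
  division by 2 that rounds up, and the rounding matters only if both \<open>a2 + a5\<close> and
  \<open>a3 + a4\<close> equal \<open>s + t\<close>.
\<close>

lemma tetrahedron_lattice_point:
  fixes s t a2 a3 a4 a5 :: int
  assumes "0 \<le> s" "0 \<le> t" "0 \<le> a2" "0 \<le> a3" "0 \<le> a4" "0 \<le> a5"
    and "a2 + a5 \<le> s + t" "a3 + a4 \<le> s + t" "a2 + a4 \<le> s + 2 * t" "a3 + a5 \<le> s + 2 * t"
    and "a2 + a3 \<le> 2 * s + t" "a4 + a5 \<le> 2 * s + t"
    and parity: "a2 + a5 = s + t \<Longrightarrow> a3 + a4 = s + t \<Longrightarrow> even (a2 + a3 - t)"
  shows "\<exists>u v. 0 \<le> u \<and> u \<le> s \<and> 0 \<le> v \<and> v \<le> t \<and> a2 \<le> u + v \<and> a3 \<le> u + (t - v)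
    \<and> a4 \<le> (s - u) + v \<and> a5 \<le> (s - u) + (t - v)"
proof -
  \<comment> \<open>The least integer with \<open>2 h \<ge> a2 + a3 - t\<close>.\<close>
  define h where "h = (a2 + a3 - t + 1) div 2"
  \<comment> \<open>The least value that meets all lower bounds for \<open>u\<close>; likewise for \<open>v\<close> below.\<close>
  define u where "u = Max {0, a3 - t, a2 - t, h}"
  have half: "a2 + a3 - t \<le> 2 * h" "2 * h \<le> a2 + a3 - t + 1" unfolding h_def by presburger+
  have half_even: "even (a2 + a3 - t) \<Longrightarrow> 2 * h = a2 + a3 - t" unfolding h_def by presburger
  have lower: "0 \<le> u" "a3 - t \<le> u" "a2 - t \<le> u" "h \<le> u"
    by (simp_all add: u_def)
  have "2 * h \<le> 2 * s + t - a4 - a5"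
  proof (cases "even (a2 + a3 - t)")
    case True then show ?thesis using half_even assms by linarith
  next
    case False
    then have "a2 + a5 \<noteq> s + t \<or> a3 + a4 \<noteq> s + t" using parity by blast
    then show ?thesis using half assms by linarith
  qed
  moreover have "u = 0 \<or> u = a3 - t \<or> u = a2 - t \<or> u = h"
    by (auto simp: u_def max_def)
  ultimately have upper: "2 * u \<le> 2 * s + t - a4 - a5" "u \<le> s" "u \<le> s + t - a5" "u \<le> s + t - a4"
    using half assms by linarith+
  define v where "v = Max {0, a2 - u, a4 - s + u}"
  have v_lower: "0 \<le> v" "a2 - u \<le> v" "a4 - s + u \<le> v" by (simp_all add: v_def)
  have "v = 0 \<or> v = a2 - u \<or> v = a4 - s + u" by (auto simp: v_def max_def)
  then have v_upper: "v \<le> t" "v \<le> u + t - a3" "v \<le> s + t - a5 - u"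
    using half lower upper assms by linarith+
  show ?thesis
    by (rule exI[of _ u], rule exI[of _ v]) (use lower upper v_lower v_upper in linarith)
qed

text \<open>
  The variables are \<open>s = u 1 + u 2\<close>, \<open>t = u 3 + u 4\<close>, \<open>u = u 1\<close> and \<open>v = u 3\<close>. Increasing \<open>s\<close> or \<open>t\<close>
  only weakens the lower bounds, so the two maximal choices \<open>(a1 - 2, a6 - 1)\<close> and \<open>(a1 - 1, a6 - 2)\<close> suffice.
  Whenever the second one fails, the inequality or parity that fails forces the first one to be good.
\<close>

lemma matching_slack_iff:
  fixes a1 a2 a3 a4 a5 a6 :: int
  assumes nonneg: "0 \<le> a1" "0 \<le> a2" "0 \<le> a3" "0 \<le> a4" "0 \<le> a5" "0 \<le> a6"
  shows "(\<exists>s t u v. 0 \<le> u \<and> u \<le> s \<and> 0 \<le> v \<and> v \<le> t \<and> s < a1 \<and> t < a6 \<and> s + t < a1 + a6 - 2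
      \<and> a2 \<le> u + v \<and> a3 \<le> u + (t - v) \<and> a4 \<le> (s - u) + v \<and> a5 \<le> (s - u) + (t - v)) \<longleftrightarrow>
    a1 \<noteq> 0 \<and> a6 \<noteq> 0 \<and> a1 + a6 - 2 >
      Max {a2 + a5, a3 + a4, a2 + a4 - a6 + 1, a3 + a5 - a6 + 1, a2 + a3 - a1 + 1, a4 + a5 - a1 + 1}"
    (is "?L \<longleftrightarrow> ?R")
proof
  assume ?L
  then obtain s t u v where "0 \<le> u \<and> u \<le> s \<and> 0 \<le> v \<and> v \<le> t \<and> s < a1 \<and> t < a6 \<and> s + t < a1 + a6 - 2
      \<and> a2 \<le> u + v \<and> a3 \<le> u + (t - v) \<and> a4 \<le> (s - u) + v \<and> a5 \<le> (s - u) + (t - v)"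
    by (elim exE)
  then show ?R by simp
next
  assume R: ?R
  let ?P = "\<lambda>s t u v. 0 \<le> u \<and> u \<le> s \<and> 0 \<le> v \<and> v \<le> t \<and> a2 \<le> u + v \<and> a3 \<le> u + (t - v)
    \<and> a4 \<le> (s - u) + v \<and> a5 \<le> (s - u) + (t - v)"
  define m where "m = a1 + a6 - 3"
  have "\<forall>z \<in> {a2 + a5, a3 + a4, a2 + a4 - a6 + 1, a3 + a5 - a6 + 1, a2 + a3 - a1 + 1, a4 + a5 - a1 + 1}.
      z < a1 + a6 - 2"
    using R by (subst (asm) Max_less_iff) (simp, simp, blast)
  then have "a2 + a5 < a1 + a6 - 2" "a3 + a4 < a1 + a6 - 2" "a2 + a4 - a6 + 1 < a1 + a6 - 2"
      "a3 + a5 - a6 + 1 < a1 + a6 - 2" "a2 + a3 - a1 + 1 < a1 + a6 - 2" "a4 + a5 - a1 + 1 < a1 + a6 - 2"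
    by blast+
  moreover have "a1 \<noteq> 0" "a6 \<noteq> 0" using R by blast+
  ultimately have bounds: "a2 + a5 \<le> m" "a3 + a4 \<le> m" "a2 + a4 \<le> m + a6 - 1" "a3 + a5 \<le> m + a6 - 1"
      "a2 + a3 \<le> m + a1 - 1" "a4 + a5 \<le> m + a1 - 1" "1 \<le> a1" "1 \<le> a6"
    using nonneg m_def by linarith+
  let ?good = "\<lambda>s t. 0 \<le> s \<and> 0 \<le> t \<and> a2 + a4 \<le> s + 2 * t \<and> a3 + a5 \<le> s + 2 * t
      \<and> a2 + a3 \<le> 2 * s + t \<and> a4 + a5 \<le> 2 * s + t
      \<and> (a2 + a5 = s + t \<longrightarrow> a3 + a4 = s + t \<longrightarrow> even (a2 + a3 - t))"
  have point: "\<exists>u v. ?P s t u v" if good: "?good s t" and sum: "s + t = m" for s t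
  proof (rule tetrahedron_lattice_point)
    show "0 \<le> s" "0 \<le> t" using good by blast+
    show "a2 + a4 \<le> s + 2 * t" "a3 + a5 \<le> s + 2 * t" "a2 + a3 \<le> 2 * s + t" "a4 + a5 \<le> 2 * s + t"
      using good by blast+
    show "even (a2 + a3 - t)" if "a2 + a5 = s + t" "a3 + a4 = s + t" using good that by blast
  qed (use nonneg bounds sum in blast)+
  have "(\<exists>u v. ?P (a1 - 2) (a6 - 1) u v) \<or> (\<exists>u v. ?P (a1 - 1) (a6 - 2) u v)"
  proof (cases "?good (a1 - 1) (a6 - 2)")
    case True
    then have "\<exists>u v. ?P (a1 - 1) (a6 - 2) u v" by (rule point) (simp add: m_def)
    then show ?thesis ..
  next
    case False
    have fail: "a6 = 1 \<or> a2 + a4 = m + a6 - 1 \<or> a3 + a5 = m + a6 - 1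
      \<or> (a2 + a5 = m \<and> a3 + a4 = m \<and> odd (a2 + a3 - (a6 - 2)))"
    proof (rule ccontr)
      assume "\<not> ?thesis"
      then have "?good (a1 - 1) (a6 - 2)" using bounds unfolding m_def by auto
      with False show False by contradiction
    qed
    have parity: "even (a2 + a3 - (a6 - 1))" if eq: "a2 + a5 = m" "a3 + a4 = m"
      using fail
    proof (elim disjE conjE)
      assume "a6 = 1"
      then have "a2 + a3 - (a6 - 1) = 2 * a2" using eq bounds by linarith
      then show ?thesis by (simp only: dvd_triv_left)
    next
      assume "a2 + a4 = m + a6 - 1"
      then have "a2 + a3 - (a6 - 1) = 2 * a3" using eq by linarith
      then show ?thesis by (simp only: dvd_triv_left)
    next
      assume "a3 + a5 = m + a6 - 1"
      then have "a2 + a3 - (a6 - 1) = 2 * a2" using eq by linarith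
      then show ?thesis by (simp only: dvd_triv_left)
    next
      assume "odd (a2 + a3 - (a6 - 2))"
      then show ?thesis by presburger
    qed
    have "a1 \<noteq> 1 \<and> a2 + a3 \<noteq> m + a1 - 1 \<and> a4 + a5 \<noteq> m + a1 - 1"
      using fail
    proof (elim disjE conjE)
      assume eq: "a2 + a5 = m" "a3 + a4 = m" and odd: "odd (a2 + a3 - (a6 - 2))"
      \<comment> \<open>The excluded cases would make this odd number 0 or \<open>2 (a1 - 1)\<close>.\<close>
      have "a2 + a3 - (a6 - 2) \<noteq> 0" using odd by (metis even_zero)
      moreover have "a2 + a3 - (a6 - 2) \<noteq> 2 * (a1 - 1)" using odd by (metis dvd_triv_left)
      ultimately show ?thesis using eq bounds unfolding m_def by auto
    qed (use bounds nonneg in \<open>auto simp: m_def\<close>)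
    then have "?good (a1 - 2) (a6 - 1)"
      using bounds parity unfolding m_def by auto
    then have "\<exists>u v. ?P (a1 - 2) (a6 - 1) u v" by (rule point) (simp add: m_def)
    then show ?thesis ..
  qed
  then obtain s t where "\<exists>u v. ?P s t u v" and st: "s < a1" "t < a6" "s + t < a1 + a6 - 2"
  proof (elim disjE)
    assume "\<exists>u v. ?P (a1 - 2) (a6 - 1) u v"
    then show thesis by (rule that) simp_all
  next
    assume "\<exists>u v. ?P (a1 - 1) (a6 - 2) u v"
    then show thesis by (rule that) simp_all
  qed
  then obtain u v where "?P s t u v" by (elim exE)
  then show ?L by (intro exI[of _ s] exI[of _ t] exI[of _ u] exI[of _ v]) (simp add: st)
qed

section \<open>The criterion\<close>

lemma Inf_enat_le_one_iff:
  "Inf {enat k | k. P k} \<le> 1 \<longleftrightarrow> P 0 \<or> P 1"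
proof
  assume L: "Inf {enat k | k. P k} \<le> 1"
  have "{enat k | k. P k} \<noteq> {}"
  proof
    assume "{enat k | k. P k} = {}"
    then have "Inf {enat k | k. P k} = \<infinity>" by (simp only: Inf_empty top_enat_def)
    with L show False by simp
  qed
  then have "Inf {enat k | k. P k} \<in> {enat k | k. P k}"
    unfolding Inf_enat_def by (auto intro: LeastI)
  then obtain k where "P k" "enat k \<le> 1" using L by auto
  moreover from this have "k = 0 \<or> k = 1" by (auto simp: one_enat_def)
  ultimately show "P 0 \<or> P 1" by auto
next
  assume "P 0 \<or> P 1"
  then consider "P 0" | "P 1" by blast
  then show "Inf {enat k | k. P k} \<le> 1"
  proof cases
    case 1
    then have "Inf {enat k | k. P k} \<le> enat 0" by (intro Inf_lower) auto
    then show ?thesis by (simp add: zero_enat_def[symmetric])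
  next
    case 2
    then have "Inf {enat k | k. P k} \<le> enat 1" by (intro Inf_lower) auto
    then show ?thesis by (simp add: one_enat_def)
  qed
qed

lemma ideal_power_max_ideal:
  "ideal_power poly4_ring (max_ideal :: 'k::field poly4 set) 0 = UNIV"
  "ideal_power poly4_ring (max_ideal :: 'k::field poly4 set) 1 = max_ideal"
proof -
  interpret cring "R :: 'k poly4 ring" by (rule cring_R)
  have ideal: "ideal (max_ideal :: 'k poly4 set) R"
    unfolding max_ideal_def by (rule genideal_ideal) simp
  have "ideal_prod R UNIV max_ideal = (max_ideal :: 'k poly4 set)"
    using ideal_prod_one[OF ideal] ideal_prod_commute[OF ideal oneideal] by simp
  then show "ideal_power poly4_ring (max_ideal :: 'k poly4 set) 0 = UNIV"
    "ideal_power poly4_ring (max_ideal :: 'k poly4 set) 1 = max_ideal"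
    by (simp_all add: ideal_power_def nat_pow_def ideals_set_def)
qed

lemma arithmetically_Buchsbaum_iff:
  "arithmetically_Buchsbaum (I :: 'k::field poly4 set) \<longleftrightarrow> annihilates max_ideal (H1_m I)"
  unfolding arithmetically_Buchsbaum_def k_invariant_def Inf_enat_le_one_iff ideal_power_max_ideal
  by (auto simp: annihilates_def)

theorem theorem3p7:
  fixes a1 a2 a3 a4 a5 a6 :: nat and A :: int
  assumes "\<not> (a1 = 0 \<and> a2 = 0 \<and> a3 = 0 \<and> a4 = 0 \<and> a5 = 0 \<and> a6 = 0)"
    and "a1 + a6 \<ge> max (a2 + a5) (a3 + a4)"
    and "A = Max {int a2 + int a5, int a3 + int a4,
                  int a2 + int a4 - int a6 + 1, int a3 + int a5 - int a6 + 1,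
                  int a2 + int a3 - int a1 + 1, int a4 + int a5 - int a1 + 1}"
  shows "arithmetically_Buchsbaum (tetrahedral_ideal a1 a2 a3 a4 a5 a6 :: 'k::field poly4 set) \<longleftrightarrow>
           (a1 = 0 \<or> a6 = 0) \<or> int a1 + int a6 - 2 \<le> A"
proof -
  let ?\<alpha> = "line_weight a1 a2 a3 a4 a5 a6"
  interpret tetrahedral ?\<alpha> "tetrahedral_ideal a1 a2 a3 a4 a5 a6 :: 'k poly4 set"
    by unfold_locales (simp_all add: line_weight_commute tetrahedral_ideal_eq)
  note [simp] = line_weight_simps
  have lead: "exact_matching w 1 2 3 4" if mat: "exact_matching w i m j k" for w i m j k
  proof -
    have swap: "exact_matching w m i j k" "exact_matching w j k i m"
      if "exact_matching w i m j k" for i m j k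
      using that edge_sym[of w] unfolding exact_matching_def by auto
    have d: "distinct [i, m, j, k]" using mat by (simp add: exact_matching_def)
    have "\<exists>m j k. exact_matching w 1 m j k"
      using distinct4_cover[OF d, of 1] mat swap by blast
    then obtain m j k where mat1: "exact_matching w 1 m j k" by blast
    \<comment> \<open>Summing the four relevant inequalities contradicts the assumption on \<open>a1 + a6\<close>.\<close>
    have crossing: "\<not> exact_matching w 1 3 2 4" "\<not> exact_matching w 1 4 2 3"
      using assms(2) by (auto simp: exact_matching_def edge_def)
    have "distinct [1, m, j, k]" using mat1 by (simp add: exact_matching_def)
    then consider "m = 2" "j = 3" "k = 4" | "m = 2" "j = 4" "k = 3" | "m = 3" "j = 2" "k = 4"
      | "m = 3" "j = 4" "k = 2" | "m = 4" "j = 2" "k = 3" | "m = 4" "j = 3" "k = 2"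
      using exhaust_idx[of m] exhaust_idx[of j] exhaust_idx[of k] by (simp, metis)
    then show ?thesis using mat1 swap crossing by cases blast+
  qed
  have matching: "exact_matching w 1 2 3 4 \<longleftrightarrow>
      Poly_Mapping.lookup w 1 + Poly_Mapping.lookup w 2 < a1 \<and> Poly_Mapping.lookup w 3 + Poly_Mapping.lookup w 4 < a6 \<and>
      a2 \<le> Poly_Mapping.lookup w 1 + Poly_Mapping.lookup w 3 \<and> a3 \<le> Poly_Mapping.lookup w 1 + Poly_Mapping.lookup w 4 \<and>
      a4 \<le> Poly_Mapping.lookup w 2 + Poly_Mapping.lookup w 3 \<and> a5 \<le> Poly_Mapping.lookup w 2 + Poly_Mapping.lookup w 4" for w
    by (auto simp: exact_matching_def edge_def)
  have "\<not> arithmetically_Buchsbaum (tetrahedral_ideal a1 a2 a3 a4 a5 a6 :: 'k poly4 set) \<longleftrightarrow>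
      (\<exists>u l. exact_matching u 1 2 3 4 \<and> exact_matching (Poly_Mapping.single l 1 + u) 1 2 3 4)"
    unfolding arithmetically_Buchsbaum_iff annihilates_max_ideal_iff using lead by blast
  also have "\<dots> \<longleftrightarrow> (\<exists>(s::int) (t::int) (u::int) (v::int). 0 \<le> u \<and> u \<le> s \<and> 0 \<le> v \<and> v \<le> t \<and> s < a1 \<and> t < a6
      \<and> s + t < int a1 + int a6 - 2
      \<and> a2 \<le> u + v \<and> a3 \<le> u + (t - v) \<and> a4 \<le> (s - u) + v \<and> a5 \<le> (s - u) + (t - v))" (is "?L \<longleftrightarrow> ?R")
  proof
    assume ?L
    then obtain u l where u: "exact_matching u 1 2 3 4" and ul: "exact_matching (Poly_Mapping.single l 1 + u) 1 2 3 4"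
      by blast
    have "Poly_Mapping.lookup u 1 + Poly_Mapping.lookup u 2 + 1 < a1 \<or> Poly_Mapping.lookup u 3 + Poly_Mapping.lookup u 4 + 1 < a6"
      using ul exhaust_idx[of l] unfolding matching by (auto simp: lookup_add lookup_single)
    then show ?R using u unfolding matching
      by (intro exI[of _ "int (Poly_Mapping.lookup u 1) + int (Poly_Mapping.lookup u 2)"]
            exI[of _ "int (Poly_Mapping.lookup u 3) + int (Poly_Mapping.lookup u 4)"]
            exI[of _ "int (Poly_Mapping.lookup u 1)"] exI[of _ "int (Poly_Mapping.lookup u 3)"] conjI; linarith)
  next
    assume ?R
    then obtain s t u v :: int where "0 \<le> u \<and> u \<le> s \<and> 0 \<le> v \<and> v \<le> t \<and> s < a1 \<and> t < a6
      \<and> s + t < int a1 + int a6 - 2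
      \<and> a2 \<le> u + v \<and> a3 \<le> u + (t - v) \<and> a4 \<le> (s - u) + v \<and> a5 \<le> (s - u) + (t - v)"
      by (elim exE)
    then have st: "0 \<le> u" "u \<le> s" "0 \<le> v" "v \<le> t" "s < a1" "t < a6"
      "s + t < int a1 + int a6 - 2"
      "a2 \<le> u + v" "a3 \<le> u + (t - v)" "a4 \<le> (s - u) + v" "a5 \<le> (s - u) + (t - v)" by simp_all
    define w where "w = Poly_Mapping.single 1 (nat u) + Poly_Mapping.single 2 (nat (s - u))
      + Poly_Mapping.single 3 (nat v) + Poly_Mapping.single (4 :: 4) (nat (t - v))"
    have w: "Poly_Mapping.lookup w 1 = nat u" "Poly_Mapping.lookup w 2 = nat (s - u)"
      "Poly_Mapping.lookup w 3 = nat v" "Poly_Mapping.lookup w 4 = nat (t - v)"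
      by (simp_all add: w_def lookup_add lookup_single)
    have "exact_matching w 1 2 3 4" unfolding matching w by (intro conjI; use st in linarith)
    moreover have "exact_matching (Poly_Mapping.single (if s + 1 < a1 then 1 else 3) 1 + w) 1 2 3 4"
    proof (cases "s + 1 < a1")
      case True
      then show ?thesis
        unfolding matching lookup_add w by (intro conjI; simp add: lookup_single; use st in linarith)
    next
      case False
      then show ?thesis
        unfolding matching lookup_add w by (intro conjI; simp add: lookup_single; use st in linarith)
    qed
    ultimately show ?L by blast
  qed
  also have "\<dots> \<longleftrightarrow> int a1 \<noteq> 0 \<and> int a6 \<noteq> 0 \<and> int a1 + int a6 - 2 > A"
    unfolding assms(3) by (rule matching_slack_iff) (rule of_nat_0_le_iff)+
  finally show ?thesis by (auto simp: not_le)
qed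

end
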